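(* (1) For every $d_1\ge 0$ there exists $c>0$ such that, with high probability, $G_n\sim G(n,d_1/n)$ is monotone $c$-tiny. (2) For every $c>0$ there exists $d_2\ge 0$ such that, with high probability, $G_n\sim G(n,d_2/n)$ is not monotone $c$-tiny.
   Context: $G(n,p)$ is the Erdős–Rényi random graph on vertex set $[n]$ in which each of the $\binom n2$ possible edges is present independently with probability $p$. An event holds with high probability (w.h.p.) if its probability tends to 1 as $n\to\infty$. For a graph $G$ and $k\ge1$, $s_k(G)$ denotes the number of unlabeled (i.e., isomorphism classes of) $k$-vertex subgraphs (not necessarily induced) of $G$. For a constant $c$, an $n$-vertex graph $G$ is monotone $c$-tiny if $s_k(G)\le c^k$ for every $k\in\{1,\dots,n\}$. *)

theory Defs
  imports "HOL-Probability.Probability"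
begin

text \<open>Simple graphs on vertex set [n] = {0..<n}: an edge is a 2-element set {i,j}
  with i < j < n.  A graph is given by its edge predicate (only edges in
  all_edges n are relevant).\<close>

definition all_edges :: "nat \<Rightarrow> nat set set" where
  "all_edges n = {e. \<exists>i j. i < j \<and> j < n \<and> e = {i, j}}"

definition Gnp :: "nat \<Rightarrow> real \<Rightarrow> (nat set \<Rightarrow> bool) pmf" where
  "Gnp n p = Pi_pmf (all_edges n) False (\<lambda>_. bernoulli_pmf p)"

definition is_sub :: "nat \<Rightarrow> nat set set \<Rightarrow> nat \<Rightarrow> (nat set \<Rightarrow> bool) \<Rightarrow> bool" where
  "is_sub k F n G \<longleftrightarrow> (\<exists>f. inj_on f {0..<k} \<and> f ` {0..<k} \<subseteq> {0..<n} \<and>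
      (\<forall>e\<in>F. f ` e \<in> all_edges n \<and> G (f ` e)))"

definition graph_iso :: "nat \<Rightarrow> nat set set \<Rightarrow> nat set set \<Rightarrow> bool" where
  "graph_iso k F F' \<longleftrightarrow> (\<exists>\<sigma>. bij_betw \<sigma> {0..<k} {0..<k} \<and>
      (\<forall>e\<in>all_edges k. e \<in> F \<longleftrightarrow> \<sigma> ` e \<in> F'))"

definition s_sub :: "nat \<Rightarrow> nat \<Rightarrow> (nat set \<Rightarrow> bool) \<Rightarrow> nat" where
  "s_sub k n G = card ((\<lambda>F. {F'. F' \<subseteq> all_edges k \<and> graph_iso k F F'}) `
                        {F. F \<subseteq> all_edges k \<and> is_sub k F n G})"

definition mono_tiny :: "real \<Rightarrow> nat \<Rightarrow> (nat set \<Rightarrow> bool) \<Rightarrow> bool" where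
  "mono_tiny c n G \<longleftrightarrow> (\<forall>k\<in>{1..n}. real (s_sub k n G) \<le> c ^ k)"

definition whp :: "(nat \<Rightarrow> real) \<Rightarrow> (nat \<Rightarrow> (nat set \<Rightarrow> bool) \<Rightarrow> bool) \<Rightarrow> bool" where
  "whp p P \<longleftrightarrow> ((\<lambda>n. measure_pmf.prob (Gnp n (p n)) {G. P n G}) \<longlonglongrightarrow> 1)"

end

theory Submission
  imports Defs
begin

text \<open>
  Part (1): a breadth-first search turns every connected graph on \<open>j\<close> vertices into one that
  contains one of at most \<open>4 ^ j\<close> canonical spanning trees. The connected subgraphs with at most
  \<open>j\<close> edges therefore contribute exponentially few isomorphism classes, while those with more edges
  occur \<open>O(C ^ j / n)\<close> times in expectation, so that Markov's inequality and a union bound over \<open>j\<close>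
  suffice. Splitting off the component of one vertex gives \<open>s_k \<le> \<Sum>j. t_j * s_(k-j)\<close> for the number
  \<open>t_j\<close> of connected classes, and \<open>t_j \<le> C ^ j\<close> implies \<open>s_k \<le> (2 * C) ^ k\<close>.

  Part (2): with high probability any two disjoint sets of \<open>s = \<epsilon> n\<close> vertices are joined by an edge.
  Depth-first search then finds a path on \<open>k > n - 2 * s\<close> vertices, and most vertices in its second half
  have at least \<open>r\<close> neighbours in its first half. Adding one such edge per vertex to the path yields at
  least \<open>r ^ (n / 4)\<close> subgraphs with at most \<open>2 * k\<close> edges. An isomorphism onto a fixed representative
  is determined by the image of the path, a set of edges, and of its first vertex, so each
  isomorphism class is hit at most \<open>4 ^ k * k\<close> times.
\<close>

section \<open>Edges and isomorphism classes\<close>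

lemma all_edges_eq: "all_edges n = {e. e \<subseteq> {0..<n} \<and> card e = 2}"
proof (intro equalityI subsetI)
  fix e assume "e \<in> {e. e \<subseteq> {0..<n} \<and> card e = 2}"
  then obtain x y where xy: "e = {x, y}" "x \<noteq> y" "x < n" "y < n"
    by (auto simp: card_2_iff)
  then have "\<exists>i j. i < j \<and> j < n \<and> {x, y} = {i, j}"
    by (metis insert_commute linorder_neqE_nat)
  with xy show "e \<in> all_edges n"
    by (auto simp: all_edges_def)
qed (auto simp: all_edges_def card_2_iff)

lemma all_edges_less: "e \<in> all_edges n \<Longrightarrow> x \<in> e \<Longrightarrow> x < n"
  by (auto simp: all_edges_def)

lemma finite_all_edges [simp]: "finite (all_edges n)"
  by (rule finite_subset[of _ "Pow {0..<n}"]) (auto simp: all_edges_eq)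

lemma card_all_edges_le: "card (all_edges n) \<le> n ^ 2"
proof -
  have "all_edges n \<subseteq> (\<lambda>(i, j). {i, j}) ` ({0..<n} \<times> {0..<n})"
    by (auto simp: all_edges_def)
  then have "card (all_edges n) \<le> card ({0..<n} \<times> {0..<n})"
    by (intro surj_card_le) auto
  then show ?thesis
    by (simp add: power2_eq_square)
qed

lemma all_edges_mono: "m \<le> n \<Longrightarrow> all_edges m \<subseteq> all_edges n"
  by (auto simp: all_edges_eq)

lemma image_all_edges:
  assumes "inj_on f {0..<k}" "f ` {0..<k} \<subseteq> {0..<n}" "e \<in> all_edges k"
  shows "f ` e \<in> all_edges n"
proof -
  have "card (f ` e) = card e"
    using assms by (intro card_image inj_on_subset[OF assms(1)]) (auto simp: all_edges_eq)
  then show ?thesis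
    using assms by (auto simp: all_edges_eq)
qed

lemma inj_on_image_all_edges: "inj_on f {0..<k} \<Longrightarrow> inj_on ((`) f) (all_edges k)"
  by (rule inj_on_subset[OF inj_on_image_Pow]) (auto simp: all_edges_eq)

section \<open>Isomorphism as an equivalence relation on labelled graphs\<close>

definition iso_class :: "nat \<Rightarrow> nat set set \<Rightarrow> nat set set set" where
  "iso_class k F = {F'. F' \<subseteq> all_edges k \<and> graph_iso k F F'}"

lemma graph_iso_refl: "graph_iso k F F"
  unfolding graph_iso_def by (rule exI[of _ id]) auto

lemma graph_iso_sym:
  assumes "graph_iso k F F'"
  shows "graph_iso k F' F"
proof -
  obtain \<sigma> where \<sigma>: "bij_betw \<sigma> {0..<k} {0..<k}" "\<forall>e\<in>all_edges k. e \<in> F \<longleftrightarrow> \<sigma> ` e \<in> F'"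
    using assms unfolding graph_iso_def by blast
  define \<tau> where "\<tau> = inv_into {0..<k} \<sigma>"
  have \<tau>: "bij_betw \<tau> {0..<k} {0..<k}"
    unfolding \<tau>_def by (rule bij_betw_inv_into[OF \<sigma>(1)])
  have "e \<in> F' \<longleftrightarrow> \<tau> ` e \<in> F" if e: "e \<in> all_edges k" for e
  proof -
    have "\<tau> ` e \<in> all_edges k"
      using image_all_edges[of \<tau> k k e] \<tau> e by (auto simp: bij_betw_def)
    moreover have "\<sigma> ` \<tau> ` e = e"
    proof -
      have "\<sigma> (\<tau> x) = x" if "x \<in> e" for x
        using bij_betw_inv_into_right[OF \<sigma>(1)] all_edges_less[OF e that] by (simp add: \<tau>_def)
      then show ?thesis
        by (simp add: image_image)
    qed
    ultimately show ?thesis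
      using \<sigma>(2) by metis
  qed
  with \<tau> show ?thesis
    unfolding graph_iso_def by blast
qed

lemma graph_iso_trans:
  assumes "graph_iso k F F'" "graph_iso k F' F''"
  shows "graph_iso k F F''"
proof -
  obtain \<sigma> where \<sigma>: "bij_betw \<sigma> {0..<k} {0..<k}" "\<forall>e\<in>all_edges k. e \<in> F \<longleftrightarrow> \<sigma> ` e \<in> F'"
    using assms(1) unfolding graph_iso_def by blast
  obtain \<tau> where \<tau>: "bij_betw \<tau> {0..<k} {0..<k}" "\<forall>e\<in>all_edges k. e \<in> F' \<longleftrightarrow> \<tau> ` e \<in> F''"
    using assms(2) unfolding graph_iso_def by blast
  have "e \<in> F \<longleftrightarrow> (\<tau> \<circ> \<sigma>) ` e \<in> F''" if e: "e \<in> all_edges k" for e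
  proof -
    have "\<sigma> ` e \<in> all_edges k"
      using image_all_edges[of \<sigma> k k e] \<sigma>(1) e by (auto simp: bij_betw_def)
    then show ?thesis
      using \<sigma>(2) \<tau>(2) e by (metis image_comp)
  qed
  with bij_betw_trans[OF \<sigma>(1) \<tau>(1)] show ?thesis
    unfolding graph_iso_def by blast
qed

text \<open>The assumption puts \<open>F\<close> into its own class, which gives the forward
  direction; the converse is symmetry and transitivity.\<close>

lemma iso_class_eq_iff:
  assumes "F \<subseteq> all_edges k"
  shows "iso_class k F = iso_class k F' \<longleftrightarrow> graph_iso k F' F"
proof
  assume "iso_class k F = iso_class k F'"
  then have "F \<in> iso_class k F'"
    using assms graph_iso_refl by (auto simp: iso_class_def)
  then show "graph_iso k F' F"
    by (simp add: iso_class_def)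
next
  assume "graph_iso k F' F"
  then show "iso_class k F = iso_class k F'"
    unfolding iso_class_def using graph_iso_trans graph_iso_sym by blast
qed

lemma s_sub_eq: "s_sub k n G = card (iso_class k ` {F. F \<subseteq> all_edges k \<and> is_sub k F n G})"
  by (simp add: s_sub_def iso_class_def)

section \<open>Canonical spanning trees\<close>

text \<open>
  States of a breadth-first search: the vertices are numbered in order of discovery, \<open>i\<close> of them
  have been discovered, and the first \<open>m\<close> have no undiscovered neighbours left. A finished search
  has \<open>m = i\<close>.
\<close>

inductive bfs_tree :: "nat \<Rightarrow> nat \<Rightarrow> nat set set \<Rightarrow> bool" where
  root: "bfs_tree 1 0 {}"
| add: "bfs_tree i m T \<Longrightarrow> m < i \<Longrightarrow> bfs_tree (Suc i) m (insert {m, i} T)"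
| skip: "bfs_tree i m T \<Longrightarrow> m < i \<Longrightarrow> bfs_tree i (Suc m) T"

lemma bfs_tree_edges: "bfs_tree i m T \<Longrightarrow> T \<subseteq> all_edges i"
proof (induction rule: bfs_tree.induct)
  case (add i m T)
  have "{m, i} \<in> all_edges (Suc i)"
    using \<open>m < i\<close> by (auto simp: all_edges_def)
  moreover have "all_edges i \<subseteq> all_edges (Suc i)"
    by (rule all_edges_mono) simp
  ultimately show ?case
    using add.IH by blast
qed auto

lemma bfs_tree_finite: "bfs_tree i m T \<Longrightarrow> finite T"
  by (meson bfs_tree_edges finite_all_edges finite_subset)

lemma bfs_tree_card: "bfs_tree i m T \<Longrightarrow> Suc (card T) = i"
proof (induction rule: bfs_tree.induct)
  case (add i m T)
  then have "{m, i} \<notin> T"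
    using bfs_tree_edges[OF add(1)] by (auto simp: all_edges_eq)
  with add bfs_tree_finite[OF add(1)] show ?case
    by simp
qed auto

text \<open>Each step after the root raises \<open>i + m\<close> by one and is one of two kinds:
  \<open>A\<close> collects the results of a final \<open>add\<close>, \<open>B\<close> those of a
  final \<open>skip\<close>. The edge added by \<open>add\<close> is determined by the state, so the
  bound at most doubles per step.\<close>

lemma bfs_trees: "finite {T. bfs_tree i m T} \<and> card {T. bfs_tree i m T} \<le> 2 ^ (i + m)"
proof (induction "i + m" arbitrary: i m rule: less_induct)
  case less
  define A where "A = (if i = 0 then {} else insert {m, i - 1} ` {T. bfs_tree (i - 1) m T})"
  define B where "B = (if m = 0 then {} else {T. bfs_tree i (m - 1) T})"
  have A: "finite A \<and> 2 * card A \<le> 2 ^ (i + m)"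
  proof (cases "i = 0")
    case False
    then have IH: "finite {T. bfs_tree (i - 1) m T} \<and> card {T. bfs_tree (i - 1) m T} \<le> 2 ^ (i - 1 + m)"
      by (intro less) auto
    have "card A \<le> card {T. bfs_tree (i - 1) m T}"
      using IH False by (simp add: A_def card_image_le)
    moreover have "2 * 2 ^ (i - 1 + m) = (2::nat) ^ (i + m)"
      using False by (simp flip: power_Suc)
    ultimately show ?thesis
      using IH False unfolding A_def by simp
  qed (simp add: A_def)
  have B: "finite B \<and> 2 * card B \<le> 2 ^ (i + m)"
  proof (cases "m = 0")
    case False
    then have "finite {T. bfs_tree i (m - 1) T} \<and> card {T. bfs_tree i (m - 1) T} \<le> 2 ^ (i + (m - 1))"
      by (intro less) auto
    moreover have "2 * 2 ^ (i + (m - 1)) = (2::nat) ^ (i + m)"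
      using False by (simp flip: power_Suc)
    ultimately show ?thesis
      using False unfolding B_def by simp
  qed (simp add: B_def)
  show ?case
  \<comment> \<open>Only this state can come from \<open>root\<close>; in all others the last step
    was \<open>add\<close> or \<open>skip\<close>.\<close>
  proof (cases "i = 1 \<and> m = 0")
    case True
    have "{T. bfs_tree 1 0 T} \<subseteq> {{}}"
    proof
      fix T assume "T \<in> {T. bfs_tree 1 0 T}"
      then have "bfs_tree 1 0 T" by simp
      then show "T \<in> {{}}"
        using bfs_tree_edges[of 1 0 T] by (auto simp: all_edges_def)
    qed
    then have "finite {T. bfs_tree 1 0 T}" "card {T. bfs_tree 1 0 T} \<le> card {{} :: nat set set}"
      by (rule finite_subset, simp) (use \<open>_ \<subseteq> {{}}\<close> in \<open>rule card_mono[rotated]\<close>, simp)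
    with True show ?thesis by simp
  next
    case False
    have "{T. bfs_tree i m T} \<subseteq> A \<union> B"
    proof
      fix T assume "T \<in> {T. bfs_tree i m T}"
      then have "bfs_tree i m T" by simp
      then show "T \<in> A \<union> B"
        by cases (use False in \<open>auto simp: A_def B_def\<close>)
    qed
    then have "finite {T. bfs_tree i m T}" "card {T. bfs_tree i m T} \<le> card (A \<union> B)"
      using A B by (auto intro: finite_subset card_mono)
    moreover have "card (A \<union> B) \<le> card A + card B"
      by (rule card_Un_le)
    ultimately show ?thesis
      using A B by linarith
  qed
qed

lemma finite_bfs_trees: "finite {T. bfs_tree i m T}"
  and card_bfs_trees: "card {T. bfs_tree i m T} \<le> 2 ^ (i + m)"
  using bfs_trees by blast+

text \<open>Breadth-first search in the graph \<open>E\<close> from an arbitrary vertex;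
  \<open>f\<close> lists the vertices in order of discovery. At the end \<open>m = i\<close>, so
  every discovered vertex has been scanned and the image of \<open>f\<close> is a full
  component.\<close>

lemma component_bfs_tree:
  fixes V :: "nat set" and E :: "nat set set"
  assumes "finite V" "V \<noteq> {}" and E: "\<And>e. e \<in> E \<Longrightarrow> e \<subseteq> V"
  obtains j f T where "inj_on f {0..<j}" "f ` {0..<j} \<subseteq> V" "bfs_tree j j T" "\<forall>e\<in>T. f ` e \<in> E"
    "\<forall>i<j. \<forall>w. {f i, w} \<in> E \<longrightarrow> w \<in> f ` {0..<j}"
proof -
  define St where "St i m \<longleftrightarrow> (\<exists>f T. inj_on f {0..<i} \<and> f ` {0..<i} \<subseteq> V \<and> bfs_tree i m T \<and> m \<le> i \<and>
    (\<forall>e\<in>T. f ` e \<in> E) \<and> (\<forall>l<m. \<forall>w. {f l, w} \<in> E \<longrightarrow> w \<in> f ` {0..<i}))" for i m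
  have step: "St (Suc i) m \<or> St i (Suc m)" if "St i m" "m < i" for i m
  proof -
    obtain f T where f: "inj_on f {0..<i}" "f ` {0..<i} \<subseteq> V" and T: "bfs_tree i m T" "\<forall>e\<in>T. f ` e \<in> E"
      and cl: "\<forall>l<m. \<forall>w. {f l, w} \<in> E \<longrightarrow> w \<in> f ` {0..<i}"
      using \<open>St i m\<close> unfolding St_def by blast
    show ?thesis
    proof (cases "\<exists>w. {f m, w} \<in> E \<and> w \<notin> f ` {0..<i}")
      case True
      then obtain w where w: "{f m, w} \<in> E" "w \<notin> f ` {0..<i}" by blast
      define g where "g = f(i := w)"
      have img: "g ` {0..<Suc i} = insert w (f ` {0..<i})"
        by (auto simp: g_def atLeast0_lessThan_Suc)
      have "inj_on g {0..<Suc i}"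
        using inj_on_fun_updI[OF f(1) w(2), of i] w(2)
        unfolding g_def atLeast0_lessThan_Suc by (subst inj_on_insert) auto
      moreover have "g ` {0..<Suc i} \<subseteq> V"
        using E[OF w(1)] f(2) img by auto
      moreover have "bfs_tree (Suc i) m (insert {m, i} T)"
        using T(1) \<open>m < i\<close> by (rule bfs_tree.add)
      moreover have "g ` e \<in> E" if "e \<in> insert {m, i} T" for e
      proof (cases "e = {m, i}")
        case True
        then show ?thesis using w(1) \<open>m < i\<close> by (simp add: g_def)
      next
        case False
        then have "e \<in> T" using that by blast
        then have "i \<notin> e"
          using bfs_tree_edges[OF T(1)] all_edges_less by blast
        then have "g ` e = f ` e"
          by (auto simp: g_def)
        then show ?thesis using T(2) \<open>e \<in> T\<close> by auto
      qed
      moreover have "w' \<in> g ` {0..<Suc i}" if "l < m" "{g l, w'} \<in> E" for l w'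
        using that cl \<open>m < i\<close> unfolding img by (auto simp: g_def)
      ultimately have "St (Suc i) m"
        unfolding St_def using \<open>m < i\<close> by (intro exI[of _ g] exI[of _ "insert {m, i} T"]) auto
      then show ?thesis ..
    next
      case False
      then have "St i (Suc m)"
        unfolding St_def using f T cl \<open>m < i\<close>
        by (intro exI[of _ f] exI[of _ T]) (auto simp: less_Suc_eq intro: bfs_tree.skip)
      then show ?thesis ..
    qed
  qed
  have bound: "i \<le> card V" if "St i m" for i m
  proof -
    obtain f where "inj_on f {0..<i}" "f ` {0..<i} \<subseteq> V"
      using \<open>St i m\<close> unfolding St_def by blast
    then show ?thesis
      using card_inj_on_le[of f "{0..<i}" V] \<open>finite V\<close> by simp
  qed
  have final: "\<exists>j. St j j" if "St i m" for i m
    using that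
  \<comment> \<open>Each step raises \<open>i + m\<close>, which
    \<open>m \<le> i \<le> card V\<close> keeps at most \<open>2 * card V\<close>.\<close>
  proof (induction "2 * card V - (i + m)" arbitrary: i m rule: less_induct)
    case less
    have "m \<le> i" "i \<le> card V"
      using less.prems bound by (auto simp: St_def)
    show ?case
    proof (cases "m = i")
      case False
      then have "m < i" using \<open>m \<le> i\<close> by simp
      with step[OF less.prems] consider "St (Suc i) m" | "St i (Suc m)" by blast
      then show ?thesis
        by cases (use less.hyps[of "Suc i" m] less.hyps[of i "Suc m"] \<open>m < i\<close> \<open>i \<le> card V\<close> in auto)
    qed (use less.prems in auto)
  qed
  obtain v where "v \<in> V" using \<open>V \<noteq> {}\<close> by blast
  then have "St 1 0"
    unfolding St_def by (intro exI[of _ "\<lambda>_. v"] exI[of _ "{}"]) (use bfs_tree.root in auto)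
  from final[OF this] obtain j where "St j j" ..
  then show thesis
    unfolding St_def using that by blast
qed

section \<open>Bounding the number of subgraphs by connected ones\<close>

text \<open>Every connected graph has a labelling in order of discovery, so counting only labelled
  graphs that contain such a tree still bounds the number of connected isomorphism classes. This
  avoids the factorially many labellings of a tree.\<close>

definition conn_subs :: "nat \<Rightarrow> (nat set \<Rightarrow> bool) \<Rightarrow> nat \<Rightarrow> nat set set set" where
  "conn_subs n G j = {F. F \<subseteq> all_edges j \<and> (\<exists>T\<subseteq>F. bfs_tree j j T) \<and> is_sub j F n G}"

lemma finite_conn_subs: "finite (conn_subs n G j)"
  by (rule finite_subset[of _ "Pow (all_edges j)"]) (auto simp: conn_subs_def)

lemma s_sub_le_card:
  assumes "finite R"
    and "\<And>F. F \<subseteq> all_edges k \<Longrightarrow> is_sub k F n G \<Longrightarrow> \<exists>F'\<in>R. graph_iso k F F'"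
  shows "s_sub k n G \<le> card R"
proof -
  have "iso_class k ` {F. F \<subseteq> all_edges k \<and> is_sub k F n G} \<subseteq> iso_class k ` R"
  proof clarify
    fix F assume F: "F \<subseteq> all_edges k" "is_sub k F n G"
    with assms(2) obtain F' where "F' \<in> R" "graph_iso k F F'" by blast
    with F show "iso_class k F \<in> iso_class k ` R"
      using iso_class_eq_iff[OF F(1), of F'] graph_iso_sym by (metis imageI)
  qed
  then have "s_sub k n G \<le> card (iso_class k ` R)"
    unfolding s_sub_eq using \<open>finite R\<close> by (intro card_mono) auto
  also have "\<dots> \<le> card R"
    using \<open>finite R\<close> by (rule card_image_le)
  finally show ?thesis .
qed

lemma sum_half_powers_le: "(\<Sum>j = 1..k. (1 / 2 :: real) ^ j) \<le> 1"
proof -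
  have "(\<Sum>j = 1..k. (1 / 2 :: real) ^ j) = 1 - (1 / 2) ^ k"
    by (induction k) auto
  then show ?thesis by simp
qed

text \<open>Strong induction on \<open>k\<close>, splitting the vertex set into one component with
  \<open>j\<close> vertices and the rest. The statement speaks of vertex and edge sets inside the
  host graph, so that the rest is again an instance; \<open>F\<close> is the graph seen through a
  numbering \<open>g\<close> of \<open>V\<close>.\<close>

lemma subgraph_representatives:
  fixes C :: real
  assumes C: "\<And>j. j \<in> {1..n} \<Longrightarrow> real (card (conn_subs n G j)) \<le> C ^ j" "C > 0"
  shows "k \<le> n \<Longrightarrow> \<exists>R. finite R \<and> real (card R) \<le> (2 * C) ^ k \<and>
    (\<forall>V E. V \<subseteq> {0..<n} \<and> card V = k \<and> (\<forall>e\<in>E. e \<subseteq> V \<and> e \<in> all_edges n \<and> G e) \<longrightarrow>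
      (\<exists>F\<in>R. \<exists>g. bij_betw g {0..<k} V \<and> F \<subseteq> all_edges k \<and> E = (`) g ` F))"
    (is "_ \<Longrightarrow> \<exists>R. ?P k R")
proof (induction k rule: less_induct)
  case (less k)
  show ?case
  proof (cases "k = 0")
    case True
    have "E = {}" if "V \<subseteq> {0..<n}" "card V = 0" "\<forall>e\<in>E. e \<subseteq> V \<and> e \<in> all_edges n \<and> G e"
      for V :: "nat set" and E
    proof -
      have "finite V" using that(1) by (rule finite_subset) simp
      then have "V = {}" using that(2) by simp
      with that(3) show ?thesis by (auto simp: all_edges_eq)
    qed
    then show ?thesis
      using True by (intro exI[of _ "{{}}"]) (fastforce simp: bij_betw_def dest: finite_subset)
  next
    case False
    have "\<forall>m. \<exists>R. m < k \<longrightarrow> ?P m R"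
    proof
      fix m show "\<exists>R. m < k \<longrightarrow> ?P m R"
      proof (cases "m < k")
        case True
        with less.prems have "\<exists>R. ?P m R" by (intro less.IH) auto
        then show ?thesis by (elim exE) (rule exI, rule impI)
      qed simp
    qed
    then obtain R where R0: "\<forall>m. m < k \<longrightarrow> ?P m (R m)" by (rule choice[THEN exE])
    have R: "?P m (R m)" if "m < k" for m by (rule R0[THEN spec, THEN mp, OF that])
    have R_finite: "finite (R m)" if "m < k" for m
      using R[OF that] by (rule conjunct1)
    have R_card: "real (card (R m)) \<le> (2 * C) ^ m" if "m < k" for m
      using R[OF that] by (elim conjE)
    have R_rep: "\<exists>F\<in>R m. \<exists>g. bij_betw g {0..<m} V \<and> F \<subseteq> all_edges m \<and> E = (`) g ` F"
      if "m < k" "V \<subseteq> {0..<n}" "card V = m" "\<forall>e\<in>E. e \<subseteq> V \<and> e \<in> all_edges n \<and> G e" for m V E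
      using R[OF that(1)] that(2-) by (elim conjE allE[of _ V] allE[of _ E]) blast
    \<comment> \<open>\<open>A\<close> keeps the labels below \<open>j\<close>, \<open>B\<close> is
      shifted to the labels from \<open>j\<close> on.\<close>
    define join where "join j = (\<lambda>(A, B). A \<union> (`) ((+) j) ` B)" for j :: nat
    define Q where "Q = (\<Union>j\<in>{1..k}. join j ` (conn_subs n G j \<times> R (k - j)))"
    have fin: "finite (conn_subs n G j \<times> R (k - j))" if "j \<in> {1..k}" for j
      using that R_finite finite_conn_subs by auto
    have Q_finite: "finite Q"
      unfolding Q_def using fin by auto
    have Q_card: "real (card Q) \<le> (2 * C) ^ k"
    proof -
      have "card Q \<le> (\<Sum>j\<in>{1..k}. card (join j ` (conn_subs n G j \<times> R (k - j))))"
        unfolding Q_def by (rule card_UN_le) simp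
      also have "\<dots> \<le> (\<Sum>j\<in>{1..k}. card (conn_subs n G j) * card (R (k - j)))"
        using fin by (intro sum_mono) (metis card_cartesian_product card_image_le)
      finally have "real (card Q) \<le> real (\<Sum>j\<in>{1..k}. card (conn_subs n G j) * card (R (k - j)))"
        by (rule of_nat_mono)
      also have "\<dots> = (\<Sum>j\<in>{1..k}. real (card (conn_subs n G j)) * real (card (R (k - j))))"
        by simp
      also have "\<dots> \<le> (\<Sum>j\<in>{1..k}. C ^ j * (2 * C) ^ (k - j))"
        using C R_card less.prems by (intro sum_mono mult_mono) auto
      \<comment> \<open>The base \<open>2 * C\<close> instead of \<open>C\<close> leaves a factor
        \<open>(1 / 2) ^ j\<close>, so the sum over all component sizes stays below
        \<open>(2 * C) ^ k\<close>.\<close>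
      also have "\<dots> = (\<Sum>j\<in>{1..k}. (2 * C) ^ k * (1 / 2) ^ j)"
      proof (rule sum.cong)
        fix j assume "j \<in> {1..k}"
        then have "(2 * C) ^ k = (2 * C) ^ j * (2 * C) ^ (k - j)"
          by (metis atLeastAtMost_iff le_add_diff_inverse power_add)
        then show "C ^ j * (2 * C) ^ (k - j) = (2 * C) ^ k * (1 / 2) ^ j"
          by (simp add: power_mult_distrib power_one_over)
      qed simp
      also have "\<dots> = (2 * C) ^ k * (\<Sum>j\<in>{1..k}. (1 / 2) ^ j)"
        by (simp add: sum_distrib_left)
      also have "\<dots> \<le> (2 * C) ^ k * 1"
        using \<open>C > 0\<close> by (intro mult_left_mono sum_half_powers_le) auto
      finally show ?thesis by simp
    qed
    have Q_rep: "\<exists>F\<in>Q. \<exists>g. bij_betw g {0..<k} V \<and> F \<subseteq> all_edges k \<and> E = (`) g ` F"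
      if V: "V \<subseteq> {0..<n}" "card V = k" and E: "\<forall>e\<in>E. e \<subseteq> V \<and> e \<in> all_edges n \<and> G e" for V E
    proof -
      have "finite V" using V(1) by (rule finite_subset) simp
      have "V \<noteq> {}" using V(2) False by auto
      have EV: "e \<subseteq> V" if "e \<in> E" for e using E that by blast
      obtain j f T where f: "inj_on f {0..<j}" "f ` {0..<j} \<subseteq> V"
        and T: "bfs_tree j j T" "\<forall>e\<in>T. f ` e \<in> E"
        and closed: "\<forall>i<j. \<forall>w. {f i, w} \<in> E \<longrightarrow> w \<in> f ` {0..<j}"
        by (rule component_bfs_tree[OF \<open>finite V\<close> \<open>V \<noteq> {}\<close> EV]) (assumption | rule that)+
      have "j \<ge> 1" using bfs_tree_card[OF T(1)] by simp
      have cardf: "card (f ` {0..<j}) = j" using f(1) by (simp add: card_image)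
      then have "j \<le> k" using card_mono[OF \<open>finite V\<close> f(2)] V(2) by simp
      \<comment> \<open>\<open>A\<close> holds all edges of the component, not only those of the
        spanning tree \<open>T\<close>.\<close>
      define A where "A = {e \<in> all_edges j. f ` e \<in> E}"
      have "is_sub j A n G"
        unfolding is_sub_def A_def using f V E by (intro exI[of _ f]) auto
      then have A: "A \<in> conn_subs n G j"
        using T bfs_tree_edges[OF T(1)] by (auto simp: conn_subs_def A_def)
      define V' where "V' = V - f ` {0..<j}"
      define E' where "E' = {e \<in> E. e \<subseteq> V'}"
      have "V' \<subseteq> {0..<n}" "card V' = k - j" "\<forall>e\<in>E'. e \<subseteq> V' \<and> e \<in> all_edges n \<and> G e"
        using V f E cardf by (auto simp: V'_def E'_def card_Diff_subset)
      then obtain B g' where B: "B \<in> R (k - j)" "B \<subseteq> all_edges (k - j)"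
        and g': "bij_betw g' {0..<k - j} V'" "E' = (`) g' ` B"
        using R_rep[of "k - j" V' E'] \<open>j \<ge> 1\<close> \<open>j \<le> k\<close> by auto
      define g where "g i = (if i < j then f i else g' (i - j))" for i
      have g_A: "g ` e = f ` e" if "e \<in> A" for e
        using that all_edges_less by (fastforce simp: A_def g_def)
      have g_B: "g ` (+) j ` e = g' ` e" for e
        unfolding image_image by (simp add: g_def)
      have "bij_betw g {0..<k} V"
      proof -
        have "bij_betw g {0..<j} (f ` {0..<j})"
          using f(1) by (auto simp: bij_betw_def g_def inj_on_def)
        moreover have "bij_betw g {j..<k} V'"
        proof -
          have "bij_betw (\<lambda>i. i - j) {j..<k} {0..<k - j}"
            using \<open>j \<le> k\<close> by (intro bij_betwI[where g = "\<lambda>i. i + j"]) auto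
          from bij_betw_trans[OF this g'(1)] show ?thesis
            by (subst bij_betw_cong[of _ _ "g' \<circ> (\<lambda>i. i - j)"]) (auto simp: g_def)
        qed
        ultimately have "bij_betw g ({0..<j} \<union> {j..<k}) (f ` {0..<j} \<union> V')"
          by (rule bij_betw_combine) (auto simp: V'_def)
        moreover have "{0..<j} \<union> {j..<k} = {0..<k}" "f ` {0..<j} \<union> V' = V"
          using \<open>j \<le> k\<close> f(2) by (auto simp: V'_def)
        ultimately show ?thesis by simp
      qed
      moreover have "join j (A, B) \<subseteq> all_edges k"
      proof -
        have "(+) j ` e \<in> all_edges k" if "e \<in> B" for e
          using that B \<open>j \<le> k\<close> by (intro image_all_edges[of "(+) j" "k - j"]) auto
        moreover have "A \<subseteq> all_edges k"
          using all_edges_mono[OF \<open>j \<le> k\<close>] by (auto simp: A_def)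
        ultimately show ?thesis by (auto simp: join_def)
      qed
      moreover have "E = (`) g ` join j (A, B)"
      proof -
        \<comment> \<open>By \<open>closed\<close>, an edge of \<open>E\<close> that meets the
          component lies inside it, so none is lost in the split.\<close>
        have "E = (`) f ` A \<union> E'"
        proof (intro equalityI subsetI)
          fix e assume e: "e \<in> E"
          show "e \<in> (`) f ` A \<union> E'"
          proof (cases "e \<subseteq> V'")
            case False
            then obtain i where i: "i < j" "f i \<in> e"
              using E e by (fastforce simp: V'_def)
            have "card e = 2" using E e by (auto simp: all_edges_eq)
            then obtain w where w: "e = {f i, w}" "w \<noteq> f i"
              using i(2) by (auto simp: card_2_iff)
            with closed i e obtain l where l: "l < j" "w = f l" by fastforce
            then have "i \<noteq> l" using w by auto
            then have "{i, l} \<in> A"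
              using i l e w by (auto simp: A_def all_edges_eq)
            moreover have "e = f ` {i, l}" using w(1) l(2) by simp
            ultimately show ?thesis by blast
          qed (use e in \<open>auto simp: E'_def\<close>)
        qed (auto simp: A_def E'_def)
        also have "(`) f ` A = (`) g ` A"
          using g_A by (auto intro!: image_cong)
        also have "E' = (`) g ` (`) ((+) j) ` B"
          unfolding g'(2) image_image[of "(`) g"] g_B by simp
        finally show ?thesis
          by (simp add: join_def image_Un)
      qed
      moreover have "join j (A, B) \<in> Q"
        unfolding Q_def using A B \<open>j \<ge> 1\<close> \<open>j \<le> k\<close> by auto
      ultimately show ?thesis by blast
    qed
    show ?thesis
    proof (intro exI[of _ Q] conjI allI impI)
      fix V E assume "V \<subseteq> {0..<n} \<and> card V = k \<and> (\<forall>e\<in>E. e \<subseteq> V \<and> e \<in> all_edges n \<and> G e)"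
      then show "\<exists>F\<in>Q. \<exists>g. bij_betw g {0..<k} V \<and> F \<subseteq> all_edges k \<and> E = (`) g ` F"
        by (elim conjE) (rule Q_rep)
    qed (use Q_finite Q_card in auto)
  qed
qed

lemma mono_tiny_if_few_conn_subs:
  fixes C :: real
  assumes "\<And>j. j \<in> {1..n} \<Longrightarrow> real (card (conn_subs n G j)) \<le> C ^ j" "C > 0"
  shows "mono_tiny (2 * C) n G"
  unfolding mono_tiny_def
proof
  fix k assume "k \<in> {1..n}"
  then obtain R where R: "finite R" "real (card R) \<le> (2 * C) ^ k"
    and rep: "\<And>V E. V \<subseteq> {0..<n} \<Longrightarrow> card V = k \<Longrightarrow> \<forall>e\<in>E. e \<subseteq> V \<and> e \<in> all_edges n \<and> G e \<Longrightarrow>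
      \<exists>F\<in>R. \<exists>g. bij_betw g {0..<k} V \<and> F \<subseteq> all_edges k \<and> E = (`) g ` F"
    using subgraph_representatives[where k = k, OF assms] by auto
  have "s_sub k n G \<le> card R"
  proof (rule s_sub_le_card[OF R(1)])
    fix F assume F: "F \<subseteq> all_edges k" "is_sub k F n G"
    then obtain f where f: "inj_on f {0..<k}" "f ` {0..<k} \<subseteq> {0..<n}"
      "\<forall>e\<in>F. f ` e \<in> all_edges n \<and> G (f ` e)"
      by (auto simp: is_sub_def)
    have "\<forall>e\<in>(`) f ` F. e \<subseteq> f ` {0..<k} \<and> e \<in> all_edges n \<and> G e"
      using f F(1) by (force simp: all_edges_eq)
    moreover have "card (f ` {0..<k}) = k"
      using f(1) by (simp add: card_image)
    ultimately obtain F' g where F': "F' \<in> R" "F' \<subseteq> all_edges k" "(`) f ` F = (`) g ` F'"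
      and g: "bij_betw g {0..<k} (f ` {0..<k})"
      using rep[OF f(2)] by metis
    \<comment> \<open>\<open>F\<close> under \<open>f\<close> and \<open>F'\<close> under
      \<open>g\<close> are the same edge set of the host, so going out along \<open>f\<close> and
      back along \<open>g\<close> is an isomorphism.\<close>
    define \<sigma> where "\<sigma> = inv_into {0..<k} g \<circ> f"
    have \<sigma>: "bij_betw \<sigma> {0..<k} {0..<k}"
      unfolding \<sigma>_def using f(1) g
      by (intro bij_betw_trans[of f _ "f ` {0..<k}"] bij_betw_inv_into) (auto simp: bij_betw_def)
    have "e \<in> F \<longleftrightarrow> \<sigma> ` e \<in> F'" if e: "e \<in> all_edges k" for e
    proof -
      have "g (\<sigma> x) = f x" if "x \<in> e" for x
        using all_edges_less[OF e that] g by (simp add: \<sigma>_def bij_betw_inv_into_right)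
      then have ge: "g ` \<sigma> ` e = f ` e"
        by (simp add: image_image)
      have \<sigma>e: "\<sigma> ` e \<in> all_edges k"
        using \<sigma> e by (intro image_all_edges[of \<sigma> k]) (auto simp: bij_betw_def)
      have "e \<in> F \<longleftrightarrow> f ` e \<in> (`) f ` F"
        using inj_on_image_all_edges[OF f(1)] F(1) e by (metis inj_on_image_mem_iff)
      also have "\<dots> \<longleftrightarrow> g ` \<sigma> ` e \<in> (`) g ` F'"
        by (simp add: ge F'(3))
      also have "\<dots> \<longleftrightarrow> \<sigma> ` e \<in> F'"
        using inj_on_image_all_edges[of g k] g F'(2) \<sigma>e by (metis bij_betw_def inj_on_image_mem_iff)
      finally show ?thesis .
    qed
    with \<sigma> F'(1) show "\<exists>F'\<in>R. graph_iso k F F'"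
      unfolding graph_iso_def by blast
  qed
  with R(2) show "real (s_sub k n G) \<le> (2 * C) ^ k" by linarith
qed

section \<open>Probabilities in the random graph\<close>

text \<open>Independence of the edges in \<open>A\<close>. The case \<open>b = True\<close> serves
  for copies of a subgraph, \<open>b = False\<close> for empty cuts.\<close>

lemma prob_Gnp_edges:
  assumes "0 \<le> p" "p \<le> 1" "A \<subseteq> all_edges n"
  shows "measure_pmf.prob (Gnp n p) {G. \<forall>e\<in>A. G e = b} = (if b then p else 1 - p) ^ card A"
proof -
  have "{G. \<forall>e\<in>A. G e = b} = Pi (all_edges n) (\<lambda>e. if e \<in> A then {b} else UNIV)"
    using assms(3) by (auto simp: Pi_def)
  then have "measure_pmf.prob (Gnp n p) {G. \<forall>e\<in>A. G e = b} =
      (\<Prod>e\<in>all_edges n. measure_pmf.prob (bernoulli_pmf p) (if e \<in> A then {b} else UNIV))"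
    by (simp add: Gnp_def measure_Pi_pmf_Pi)
  also have "\<dots> = (\<Prod>e\<in>all_edges n. if e \<in> A then (if b then p else 1 - p) else 1)"
    using assms by (intro prod.cong) (auto simp: measure_pmf_single)
  also have "\<dots> = (\<Prod>e\<in>A. if b then p else 1 - p)"
    using assms(3) by (subst prod.inter_restrict[symmetric]) (auto simp: Int_absorb1)
  finally show ?thesis by simp
qed

text \<open>Markov's inequality for a sum of indicators.\<close>

lemma prob_card_ge_le:
  fixes M :: "'a pmf" and t :: real
  assumes "finite I" "t > 0"
  shows "measure_pmf.prob M {x. t \<le> real (card {i \<in> I. Q i x})} \<le>
    (\<Sum>i\<in>I. measure_pmf.prob M {x. Q i x}) / t"
proof -
  define u where "u x = (\<Sum>i\<in>I. indicator {x. Q i x} x :: real)" for x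
  have u: "u x = real (card {i \<in> I. Q i x})" for x
    using \<open>finite I\<close> by (simp add: u_def indicator_def sum.If_cases Int_def)
  have int: "integrable (measure_pmf M) (\<lambda>x. indicator {x. Q i x} x :: real)" for i
    by (rule measure_pmf.integrable_const_bound[where B = 1]) (auto simp: indicator_def)
  have "measure_pmf.prob M {x \<in> space (measure_pmf M). t \<le> u x} \<le> measure_pmf.expectation M u / t"
  proof (rule integral_Markov_inequality_measure[where A = "{}"])
    show "integrable (measure_pmf M) u"
      unfolding u_def using int by (intro Bochner_Integration.integrable_sum)
  qed (use \<open>t > 0\<close> in \<open>auto simp: u\<close>)
  also have "measure_pmf.expectation M u = (\<Sum>i\<in>I. measure_pmf.prob M {x. Q i x})"
    unfolding u_def using int by (subst Bochner_Integration.integral_sum) auto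
  finally show ?thesis by (simp add: u)
qed

text \<open>Union bound over the at most \<open>n ^ j\<close> injections; each maps \<open>F\<close>
  to \<open>card F\<close> distinct edges.\<close>

lemma prob_is_sub_le:
  assumes "0 \<le> p" "p \<le> 1" "F \<subseteq> all_edges j"
  shows "measure_pmf.prob (Gnp n p) {G. is_sub j F n G} \<le> real n ^ j * p ^ card F"
proof -
  \<comment> \<open>Extensional functions make \<open>I\<close> finite; an embedding and its
    restriction agree on all edges of \<open>F\<close>.\<close>
  define I where "I = {f \<in> {0..<j} \<rightarrow>\<^sub>E {0..<n}. inj_on f {0..<j} \<and> f ` {0..<j} \<subseteq> {0..<n}}"
  define ev where "ev f = {G :: nat set \<Rightarrow> bool. \<forall>e\<in>(`) f ` F. G e = True}" for f :: "nat \<Rightarrow> nat"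
  have "I \<subseteq> {0..<j} \<rightarrow>\<^sub>E {0..<n}" unfolding I_def by blast
  then have fin: "finite I" by (rule finite_subset) (simp add: finite_PiE)
  have "{G. is_sub j F n G} \<subseteq> (\<Union>f\<in>I. ev f)"
  proof clarify
    fix G assume "is_sub j F n G"
    then obtain f where f: "inj_on f {0..<j}" "f ` {0..<j} \<subseteq> {0..<n}"
      "\<forall>e\<in>F. f ` e \<in> all_edges n \<and> G (f ` e)"
      by (auto simp: is_sub_def)
    define f' where "f' = restrict f {0..<j}"
    have "f' ` e = f ` e" if "e \<in> F" for e
    proof -
      have "x \<in> {0..<j}" if "x \<in> e" for x
        using all_edges_less[of e j x] assms(3) \<open>e \<in> F\<close> that by auto
      then show ?thesis by (auto simp: f'_def)
    qed
    then have "G \<in> ev f'" using f(3) by (auto simp: ev_def)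
    moreover have "f' \<in> I"
      using f by (auto simp: I_def f'_def)
    ultimately show "G \<in> (\<Union>f\<in>I. ev f)" by blast
  qed
  then have "measure_pmf.prob (Gnp n p) {G. is_sub j F n G} \<le> measure_pmf.prob (Gnp n p) (\<Union>f\<in>I. ev f)"
    by (intro measure_pmf.finite_measure_mono) auto
  also have "\<dots> \<le> (\<Sum>f\<in>I. measure_pmf.prob (Gnp n p) (ev f))"
    using fin by (intro measure_pmf.finite_measure_subadditive_finite) auto
  also have "\<dots> = (\<Sum>f\<in>I. p ^ card F)"
  proof (rule sum.cong)
    fix f assume "f \<in> I"
    then have f: "inj_on f {0..<j}" "f ` {0..<j} \<subseteq> {0..<n}" by (auto simp: I_def)
    have "card ((`) f ` F) = card F"
      using inj_on_image_all_edges[OF f(1)] assms(3) by (intro card_image) (rule inj_on_subset)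
    moreover have "(`) f ` F \<subseteq> all_edges n"
      using image_all_edges[OF f] assms(3) by auto
    ultimately show "measure_pmf.prob (Gnp n p) (ev f) = p ^ card F"
      unfolding ev_def using prob_Gnp_edges[OF assms(1,2), of "(`) f ` F" n True] by simp
  qed simp
  also have "\<dots> = real (card I) * p ^ card F" by simp
  also have "\<dots> \<le> real n ^ j * p ^ card F"
  proof (rule mult_right_mono)
    have "card I \<le> card ({0..<j} \<rightarrow>\<^sub>E {0..<n})"
      using \<open>I \<subseteq> _\<close> by (intro card_mono finite_PiE) auto
    also have "\<dots> = n ^ j" by (simp add: card_PiE)
    finally show "real (card I) \<le> real n ^ j" by (metis of_nat_mono of_nat_power)
  qed (use assms in auto)
  finally show ?thesis .
qed

text \<open>The expansion of a product of factors \<open>p + 1\<close>, sorted by subsets. It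
  accounts for the edges added freely to a fixed graph.\<close>

lemma sum_powers_card_Pow:
  fixes p :: real
  assumes "finite X"
  shows "(\<Sum>D\<in>Pow X. p ^ card D) = (1 + p) ^ card X"
proof -
  have "(1 + p) ^ card X = (\<Prod>x\<in>X. p + 1)" by (simp add: add.commute)
  also have "\<dots> = (\<Sum>D\<in>Pow X. (\<Prod>x\<in>D. p) * (\<Prod>x\<in>X - D. 1))"
    using assms by (rule prod_add)
  finally show ?thesis by simp
qed

section \<open>Connected graphs with at least two independent cycles\<close>

text \<open>A spanning tree has \<open>j - 1\<close> edges, so \<open>j < card F\<close> means at
  least two more. For \<open>p = d / n\<close>, these \<open>j + 1\<close> edges outweigh the
  \<open>n ^ j\<close> embeddings by a factor of \<open>1 / n\<close>, up to
  \<open>d ^ (j + 1)\<close>.\<close>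

definition complex_graphs :: "nat \<Rightarrow> nat set set set" where
  "complex_graphs j = {F. F \<subseteq> all_edges j \<and> (\<exists>T\<subseteq>F. bfs_tree j j T) \<and> j < card F}"

lemma finite_complex_graphs: "finite (complex_graphs j)"
  by (rule finite_subset[of _ "Pow (all_edges j)"]) (auto simp: complex_graphs_def)

lemma card_trees: "card {T. bfs_tree j j T} \<le> 4 ^ j"
  using card_bfs_trees[of j j] by (simp add: mult_2[symmetric] power_mult)

text \<open>Such a graph is a set \<open>S\<close>, a tree with two extra edges, plus a set
  \<open>D\<close> of further edges. There are at most \<open>4 ^ j\<close> trees and
  \<open>j ^ 2\<close> choices for each extra edge; summing over \<open>D\<close> gives the power of
  \<open>1 + p\<close>.\<close>

lemma sum_complex_graphs_le:
  fixes p :: real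
  assumes "0 \<le> p"
  shows "(\<Sum>F\<in>complex_graphs j. p ^ card F) \<le> 4 ^ j * real j ^ 4 * p ^ (j + 1) * (1 + p) ^ (j ^ 2)"
proof -
  define I where "I = {S \<in> (\<lambda>(T, e, e'). insert e (insert e' T)) `
    ({T. bfs_tree j j T} \<times> all_edges j \<times> all_edges j). S \<subseteq> all_edges j \<and> card S = j + 1}"
  define J where "J = (SIGMA S:I. Pow (all_edges j - S))"
  have finI: "finite I"
    unfolding I_def using finite_bfs_trees by simp
  then have finJ: "finite J" unfolding J_def by auto
  have finS: "finite S" if "S \<subseteq> all_edges j" for S
    using that by (rule finite_subset) simp
  have *: "card I \<le> 4 ^ j * (j ^ 2 * j ^ 2)"
  proof -
    have "card I \<le> card ({T. bfs_tree j j T} \<times> all_edges j \<times> all_edges j)"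
      unfolding I_def using finite_bfs_trees
      by (intro surj_card_le[where f = "\<lambda>(T, e, e'). insert e (insert e' T)"]) auto
    also have "\<dots> = card {T. bfs_tree j j T} * (card (all_edges j) * card (all_edges j))"
      by (simp add: card_cartesian_product)
    also have "\<dots> \<le> 4 ^ j * (j ^ 2 * j ^ 2)"
      by (intro mult_mono card_trees card_all_edges_le) auto
    finally show ?thesis .
  qed
  have cardI: "real (card I) \<le> 4 ^ j * real j ^ 4"
  proof -
    have "real (card I) \<le> real (4 ^ j * (j ^ 2 * j ^ 2))"
      using * by (rule of_nat_mono)
    then show ?thesis by (simp flip: power_add)
  qed
  have "complex_graphs j \<subseteq> (\<lambda>(S, D). S \<union> D) ` J"
  proof
    fix F assume "F \<in> complex_graphs j"
    then obtain T where F: "F \<subseteq> all_edges j" "T \<subseteq> F" "bfs_tree j j T" "j < card F"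
      by (auto simp: complex_graphs_def)
    have T: "finite T" "Suc (card T) = j"
      using bfs_tree_finite[OF F(3)] bfs_tree_card[OF F(3)] by auto
    then have "2 \<le> card (F - T)"
      using F by (simp add: card_Diff_subset)
    then obtain X where X: "X \<subseteq> F - T" "card X = 2" by (meson obtain_subset_with_card_n)
    then obtain e e' where e: "X = {e, e'}" "e \<noteq> e'" by (auto simp: card_2_iff)
    define S where "S = insert e (insert e' T)"
    have "card S = j + 1" using T X e by (auto simp: S_def)
    moreover have "S \<subseteq> all_edges j" using F X e by (auto simp: S_def)
    moreover have "S \<in> (\<lambda>(T, e, e'). insert e (insert e' T)) ` ({T. bfs_tree j j T} \<times> all_edges j \<times> all_edges j)"
      by (rule image_eqI[of _ _ "(T, e, e')"]) (use F X e in \<open>auto simp: S_def\<close>)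
    ultimately have "S \<in> I"
      unfolding I_def by blast
    then have "(S, F - S) \<in> J" using F by (auto simp: J_def)
    moreover have "F = S \<union> (F - S)" using F X e by (auto simp: S_def)
    ultimately show "F \<in> (\<lambda>(S, D). S \<union> D) ` J"
      by (intro image_eqI[of _ _ "(S, F - S)"]) auto
  qed
  then have "(\<Sum>F\<in>complex_graphs j. p ^ card F) \<le> (\<Sum>F\<in>(\<lambda>(S, D). S \<union> D) ` J. p ^ card F)"
    using finJ assms by (intro sum_mono2) auto
  \<comment> \<open>Different pairs may have the same union; as the terms are nonnegative, counting
    it several times only increases the sum.\<close>
  also have "\<dots> \<le> (\<Sum>x\<in>J. p ^ card ((\<lambda>(S, D). S \<union> D) x))"
    using sum_image_le[OF finJ, of "\<lambda>F. p ^ card F" "\<lambda>(S, D). S \<union> D"] assms by (simp add: o_def)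
  also have "\<dots> = (\<Sum>S\<in>I. \<Sum>D\<in>Pow (all_edges j - S). p ^ card (S \<union> D))"
    unfolding J_def using finI by (subst sum.Sigma) (auto intro!: sum.cong)
  also have "\<dots> = (\<Sum>S\<in>I. \<Sum>D\<in>Pow (all_edges j - S). p ^ (j + 1) * p ^ card D)"
  proof (intro sum.cong refl)
    fix S D assume "S \<in> I" "D \<in> Pow (all_edges j - S)"
    then have "card (S \<union> D) = (j + 1) + card D"
      using finS[of S] finS[of D] by (subst card_Un_disjoint) (auto simp: I_def)
    then show "p ^ card (S \<union> D) = p ^ (j + 1) * p ^ card D"
      by (simp only: power_add)
  qed
  also have "\<dots> = (\<Sum>S\<in>I. p ^ (j + 1) * (1 + p) ^ card (all_edges j - S))"
    by (simp add: sum_powers_card_Pow flip: sum_distrib_left)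
  also have "\<dots> \<le> (\<Sum>S\<in>I. p ^ (j + 1) * (1 + p) ^ (j ^ 2))"
  proof (intro sum_mono mult_left_mono power_increasing)
    fix S
    show "card (all_edges j - S) \<le> j ^ 2"
      by (rule order_trans[OF card_mono[of "all_edges j"] card_all_edges_le]) auto
  qed (use assms in auto)
  also have "\<dots> = real (card I) * (p ^ (j + 1) * (1 + p) ^ (j ^ 2))"
    by simp
  also have "\<dots> \<le> (4 ^ j * real j ^ 4) * (p ^ (j + 1) * (1 + p) ^ (j ^ 2))"
    using cardI assms by (intro mult_right_mono) auto
  finally show ?thesis by (simp add: mult_ac)
qed

text \<open>With at most \<open>j\<close> edges, a graph containing a search tree is that tree or
  the tree plus one edge, which leaves at most \<open>4 ^ j + 4 ^ j * j ^ 2\<close> graphs whatever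
  \<open>G\<close> is.\<close>

lemma card_conn_subs_le:
  "card (conn_subs n G j) \<le> 4 ^ j * (1 + j ^ 2) + card {F \<in> complex_graphs j. is_sub j F n G}"
proof -
  define S where "S = {T. bfs_tree j j T} \<union> (\<lambda>(T, e). insert e T) ` ({T. bfs_tree j j T} \<times> all_edges j)"
  have finS: "finite S"
    unfolding S_def using finite_bfs_trees by auto
  have "conn_subs n G j \<subseteq> S \<union> {F \<in> complex_graphs j. is_sub j F n G}"
  proof
    fix F assume "F \<in> conn_subs n G j"
    then obtain T where F: "F \<subseteq> all_edges j" "T \<subseteq> F" "bfs_tree j j T" "is_sub j F n G"
      by (auto simp: conn_subs_def)
    show "F \<in> S \<union> {F \<in> complex_graphs j. is_sub j F n G}"
    proof (cases "j < card F")
      case False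
      have T: "finite T" "Suc (card T) = j" "finite F"
        using bfs_tree_finite[OF F(3)] bfs_tree_card[OF F(3)] finite_subset[OF F(1)] by auto
      then have "card (F - T) \<le> 1"
        using F False by (simp add: card_Diff_subset)
      moreover have "finite (F - T)" using T by simp
      ultimately have "F - T = {} \<or> (\<exists>e. F - T = {e})"
        by (cases "card (F - T)") (auto simp: card_1_singleton_iff)
      then show ?thesis
      proof
        assume "F - T = {}"
        then have "F = T" using F(2) by blast
        then show ?thesis using F(3) by (simp add: S_def)
      next
        assume "\<exists>e. F - T = {e}"
        then obtain e where e: "F - T = {e}" ..
        then have "e \<in> all_edges j" "F = insert e T" using F(1,2) by auto
        then have "F \<in> (\<lambda>(T, e). insert e T) ` ({T. bfs_tree j j T} \<times> all_edges j)"
          by (intro image_eqI[of _ _ "(T, e)"]) (use F(3) in auto)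
        then show ?thesis by (simp add: S_def)
      qed
    qed (use F in \<open>auto simp: complex_graphs_def\<close>)
  qed
  then have "card (conn_subs n G j) \<le> card (S \<union> {F \<in> complex_graphs j. is_sub j F n G})"
    using finS finite_complex_graphs by (intro card_mono) auto
  also have "\<dots> \<le> card S + card {F \<in> complex_graphs j. is_sub j F n G}"
    by (rule card_Un_le)
  also have "card S \<le> card {T. bfs_tree j j T} + card ({T. bfs_tree j j T} \<times> all_edges j)"
    unfolding S_def using finite_bfs_trees
    by (intro order_trans[OF card_Un_le] add_left_mono card_image_le) auto
  also have "\<dots> \<le> 4 ^ j + 4 ^ j * j ^ 2"
    by (auto simp: card_cartesian_product intro!: add_mono mult_mono card_trees card_all_edges_le)
  finally show ?thesis by (simp add: algebra_simps)
qed

section \<open>Tininess with high probability\<close>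

text \<open>The bound is asked for only eventually, since in the applications \<open>d / n\<close>
  may exceed \<open>1\<close> for small \<open>n\<close>.\<close>

lemma whpI:
  assumes "\<forall>\<^sub>F n in sequentially. measure_pmf.prob (Gnp n (p n)) {G. \<not> P n G} \<le> u n"
    and "u \<longlonglongrightarrow> 0"
  shows "whp p P"
  unfolding whp_def
proof (rule tendsto_sandwich)
  have "measure_pmf.prob (Gnp n (p n)) {G. \<not> P n G} = 1 - measure_pmf.prob (Gnp n (p n)) {G. P n G}" for n
    using measure_pmf.prob_compl[of "{G. P n G}" "Gnp n (p n)"]
    by (simp add: Compl_eq_Diff_UNIV[symmetric] Collect_neg_eq)
  with assms(1) show "\<forall>\<^sub>F n in sequentially. 1 - u n \<le> measure_pmf.prob (Gnp n (p n)) {G. P n G}"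
    by (auto elim!: eventually_mono)
  show "(\<lambda>n. 1 - u n) \<longlonglongrightarrow> 1"
    using tendsto_diff[OF tendsto_const assms(2), of 1] by simp
qed auto

text \<open>Combines two exponential counts into one; \<open>j \<ge> 1\<close> matters, as the left
  side is \<open>2\<close> for \<open>j = 0\<close>.\<close>

lemma add_powers_le:
  fixes a b :: real
  assumes "0 \<le> a" "0 \<le> b" "1 \<le> j"
  shows "a ^ j + b ^ j \<le> (a + b) ^ j"
proof -
  obtain i where i: "j = Suc i" using assms(3) by (cases j) auto
  have "a * a ^ i + b * b ^ i \<le> a * (a + b) ^ i + b * (a + b) ^ i"
    using assms by (intro add_mono mult_left_mono power_mono) auto
  then show ?thesis by (simp add: i algebra_simps)
qed

text \<open>Markov's inequality. The powers of \<open>n\<close> and \<open>p\<close> combine to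
  \<open>p * d ^ j\<close>, and the base becomes \<open>64 * d * exp d / t\<close>, where
  \<open>64 = 4 * 16\<close> comes from the trees and from \<open>j ^ 4 \<le> 16 ^ j\<close>; the
  bound on \<open>t\<close> makes it at most \<open>1 / 2\<close>.\<close>

lemma prob_many_complex_subgraphs:
  fixes d t :: real
  assumes "0 \<le> d" "d \<le> real n" "j \<in> {1..n}" "128 * d * exp d < t"
  shows "measure_pmf.prob (Gnp n (d / real n))
    {G. t ^ j \<le> real (card {F \<in> complex_graphs j. is_sub j F n G})} \<le> d / real n * (1 / 2) ^ j"
proof -
  define p where "p = d / real n"
  have "n > 0" using assms(3) by auto
  have p: "0 \<le> p" "p \<le> 1" using assms \<open>n > 0\<close> by (auto simp: p_def)
  have "0 \<le> 128 * d * exp d" using assms(1) by simp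
  then have "0 < t" using assms(4) by linarith
  \<comment> \<open>Since \<open>p * j \<le> p * n = d\<close>, the quadratic exponent costs only a
    factor \<open>exp d\<close> per vertex.\<close>
  have exp: "(1 + p) ^ (j ^ 2) \<le> exp d ^ j"
  proof -
    have "(1 + p) ^ (j ^ 2) \<le> exp p ^ (j ^ 2)"
      using p by (intro power_mono exp_ge_add_one_self) auto
    also have "\<dots> = exp (p * real j * real j)"
      by (simp add: exp_of_nat_mult[symmetric] power2_eq_square mult_ac)
    also have "\<dots> \<le> exp (p * real n * real j)"
      using assms(3) p by (auto intro!: mult_mono)
    also have "\<dots> = exp d ^ j"
      using \<open>n > 0\<close> by (simp add: p_def exp_of_nat_mult[symmetric] mult_ac)
    finally show ?thesis .
  qed
  have "real j ^ 4 \<le> (2 ^ j) ^ 4"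
    by (intro power_mono) (use of_nat_less_two_power[of j, where 'a = real] in auto)
  also have "\<dots> = (16::real) ^ j"
    by (simp add: power_mult[symmetric] mult.commute[of j] power_mult)
  finally have j4: "real j ^ 4 \<le> 16 ^ j" .
  have "measure_pmf.prob (Gnp n p) {G. t ^ j \<le> real (card {F \<in> complex_graphs j. is_sub j F n G})}
      \<le> (\<Sum>F\<in>complex_graphs j. measure_pmf.prob (Gnp n p) {G. is_sub j F n G}) / t ^ j"
    using \<open>0 < t\<close> by (intro prob_card_ge_le finite_complex_graphs) auto
  also have "\<dots> \<le> (\<Sum>F\<in>complex_graphs j. real n ^ j * p ^ card F) / t ^ j"
    using \<open>0 < t\<close> p by (intro divide_right_mono sum_mono prob_is_sub_le) (auto simp: complex_graphs_def)
  also have "\<dots> = real n ^ j * (\<Sum>F\<in>complex_graphs j. p ^ card F) / t ^ j"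
    by (simp add: sum_distrib_left)
  also have "\<dots> \<le> real n ^ j * (4 ^ j * real j ^ 4 * p ^ (j + 1) * (1 + p) ^ (j ^ 2)) / t ^ j"
    using \<open>0 < t\<close> p by (intro divide_right_mono mult_left_mono sum_complex_graphs_le) auto
  also have "\<dots> \<le> real n ^ j * (4 ^ j * 16 ^ j * p ^ (j + 1) * exp d ^ j) / t ^ j"
    using \<open>0 < t\<close> p j4 exp by (intro divide_right_mono mult_left_mono mult_mono) auto
  also have "\<dots> = p * ((real n * p) * 64 * exp d) ^ j / t ^ j"
    by (simp add: power_mult_distrib[of 4 16, symmetric] power_mult_distrib mult_ac)
  also have "\<dots> = p * (64 * d * exp d / t) ^ j"
    using \<open>n > 0\<close> by (simp add: p_def power_divide mult_ac)
  also have "\<dots> \<le> p * (1 / 2) ^ j"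
    using \<open>0 < t\<close> p assms by (intro mult_left_mono power_mono) (auto simp: field_simps)
  finally show ?thesis by (simp add: p_def)
qed

lemma random_graph_mono_tiny:
  fixes d :: real
  assumes "0 \<le> d"
  shows "\<exists>c>0. whp (\<lambda>n. d / real n) (\<lambda>n G. mono_tiny c n G)"
proof -
  \<comment> \<open>The summand \<open>1\<close> makes both bounds below strict, also for
    \<open>d = 0\<close>.\<close>
  define t where "t = 128 * d * exp d + 1"
  have t: "128 * d * exp d < t" "0 < t"
    using assms by (auto simp: t_def intro!: add_nonneg_pos)
  define bad where "bad n j = {G. t ^ j \<le> real (card {F \<in> complex_graphs j. is_sub j F n G})}" for n j
  \<comment> \<open>Here \<open>16\<close> covers trees and trees plus an edge, by
    \<open>1 + j ^ 2 \<le> 4 ^ j\<close>, \<open>t\<close> covers the complex graphs, and the factor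
    \<open>2\<close> is the cost of reducing to components.\<close>
  have tiny: "mono_tiny (2 * (16 + t)) n G" if "\<And>j. j \<in> {1..n} \<Longrightarrow> G \<notin> bad n j" for n G
  proof (rule mono_tiny_if_few_conn_subs)
    fix j assume j: "j \<in> {1..n}"
    have "j < 2 ^ j" by (rule less_exp)
    then have "j + 1 \<le> 2 ^ j" by linarith
    have "1 + j ^ 2 \<le> (j + 1) ^ 2"
      by (simp add: power2_eq_square)
    also have "\<dots> \<le> (2 ^ j) ^ 2"
      using \<open>j + 1 \<le> 2 ^ j\<close> by (rule power_mono) simp
    also have "\<dots> = 4 ^ j"
      by (simp add: power_mult[symmetric] mult.commute[of j] power_mult)
    finally have "4 ^ j * (1 + j ^ 2) \<le> 4 ^ j * (4 ^ j :: nat)" by (rule mult_le_mono2)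
    also have "\<dots> = 16 ^ j" by (simp flip: power_mult_distrib)
    finally have "card (conn_subs n G j) \<le> 16 ^ j + card {F \<in> complex_graphs j. is_sub j F n G}"
      using card_conn_subs_le[of n G j] by linarith
    then have "real (card (conn_subs n G j)) \<le> real (16 ^ j + card {F \<in> complex_graphs j. is_sub j F n G})"
      by (rule of_nat_mono)
    also have "\<dots> \<le> 16 ^ j + t ^ j"
      using that[OF j] by (simp add: bad_def)
    also have "\<dots> \<le> (16 + t) ^ j"
      using j t by (intro add_powers_le) auto
    finally show "real (card (conn_subs n G j)) \<le> (16 + t) ^ j" .
  qed (use t in simp)
  have "whp (\<lambda>n. d / real n) (\<lambda>n G. mono_tiny (2 * (16 + t)) n G)"
  proof (rule whpI)
    have "\<forall>\<^sub>F n in sequentially. d \<le> real n"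
      by (rule eventually_mono[OF eventually_ge_at_top[of "nat \<lceil>d\<rceil>"]]) linarith
    then show "\<forall>\<^sub>F n in sequentially.
        measure_pmf.prob (Gnp n (d / real n)) {G. \<not> mono_tiny (2 * (16 + t)) n G} \<le> d / real n"
    proof (rule eventually_mono)
      fix n assume n: "d \<le> real n"
      have "measure_pmf.prob (Gnp n (d / real n)) {G. \<not> mono_tiny (2 * (16 + t)) n G} \<le>
          measure_pmf.prob (Gnp n (d / real n)) (\<Union>j\<in>{1..n}. bad n j)"
      proof (intro measure_pmf.finite_measure_mono subsetI)
        fix G assume "G \<in> {G. \<not> mono_tiny (2 * (16 + t)) n G}"
        then show "G \<in> (\<Union>j\<in>{1..n}. bad n j)" using tiny[of n G] by blast
      qed simp
      also have "\<dots> \<le> (\<Sum>j\<in>{1..n}. measure_pmf.prob (Gnp n (d / real n)) (bad n j))"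
        by (intro measure_pmf.finite_measure_subadditive_finite) auto
      also have "\<dots> \<le> (\<Sum>j\<in>{1..n}. d / real n * (1 / 2) ^ j)"
        unfolding bad_def using assms n t by (intro sum_mono prob_many_complex_subgraphs) auto
      also have "\<dots> = d / real n * (\<Sum>j = 1..n. (1 / 2) ^ j)"
        by (simp add: sum_distrib_left)
      also have "\<dots> \<le> d / real n * 1"
        using assms by (intro mult_left_mono sum_half_powers_le) auto
      finally show "measure_pmf.prob (Gnp n (d / real n)) {G. \<not> mono_tiny (2 * (16 + t)) n G} \<le> d / real n"
        by simp
    qed
    show "(\<lambda>n. d / real n) \<longlonglongrightarrow> 0" by (rule lim_const_over_n)
  qed
  with t show ?thesis by (intro exI[of _ "2 * (16 + t)"]) auto
qed

section \<open>Long paths in expanding graphs\<close>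

text \<open>Also called having no bipartite hole of size \<open>s\<close>; disjointness ensures that
  only genuine pairs are queried.\<close>

definition expanding :: "nat \<Rightarrow> nat \<Rightarrow> (nat set \<Rightarrow> bool) \<Rightarrow> bool" where
  "expanding n s G \<longleftrightarrow> (\<forall>A B. A \<subseteq> {0..<n} \<longrightarrow> B \<subseteq> {0..<n} \<longrightarrow> A \<inter> B = {} \<longrightarrow> card A = s \<longrightarrow> card B = s \<longrightarrow>
     (\<exists>a\<in>A. \<exists>b\<in>B. G {a, b}))"

text \<open>Union bound over at most \<open>4 ^ n\<close> pairs of sets; as the two sets are
  disjoint, the cut consists of \<open>s * s\<close> distinct edges.\<close>

lemma prob_not_expanding:
  assumes "0 \<le> p" "p \<le> 1"
  shows "measure_pmf.prob (Gnp n p) {G. \<not> expanding n s G} \<le> 4 ^ n * (1 - p) ^ (s * s)"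
proof -
  define I where "I = {(A, B). A \<subseteq> {0..<n} \<and> B \<subseteq> {0..<n} \<and> A \<inter> B = {} \<and> card A = s \<and> card B = s}"
  define cut where "cut = (\<lambda>(A, B). (\<lambda>(a, b). {a, b :: nat}) ` (A \<times> B))"
  define ev where "ev x = {G. \<forall>e\<in>cut x. G e = False}" for x
  have I: "I \<subseteq> Pow {0..<n} \<times> Pow {0..<n}"
    by (auto simp: I_def)
  then have finI: "finite I" by (rule finite_subset) simp
  have "card I \<le> card (Pow {0..<n} \<times> Pow {0..<n})"
    using I by (intro card_mono) auto
  also have "\<dots> = 4 ^ n"
    by (simp add: card_cartesian_product card_Pow flip: power_mult_distrib)
  finally have "real (card I) \<le> real (4 ^ n)" by (rule of_nat_mono)
  then have cardI: "real (card I) \<le> 4 ^ n" by simp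
  have "{G. \<not> expanding n s G} \<subseteq> (\<Union>x\<in>I. ev x)"
  proof
    fix G assume "G \<in> {G. \<not> expanding n s G}"
    then obtain A B where "(A, B) \<in> I" "\<forall>a\<in>A. \<forall>b\<in>B. \<not> G {a, b}"
      unfolding expanding_def I_def by blast
    moreover from this(2) have "G \<in> ev (A, B)" by (auto simp: ev_def cut_def)
    ultimately show "G \<in> (\<Union>x\<in>I. ev x)" by blast
  qed
  then have "measure_pmf.prob (Gnp n p) {G. \<not> expanding n s G} \<le> measure_pmf.prob (Gnp n p) (\<Union>x\<in>I. ev x)"
    by (intro measure_pmf.finite_measure_mono) auto
  also have "\<dots> \<le> (\<Sum>x\<in>I. measure_pmf.prob (Gnp n p) (ev x))"
    using finI by (intro measure_pmf.finite_measure_subadditive_finite) auto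
  also have "\<dots> = (\<Sum>x\<in>I. (1 - p) ^ (s * s))"
  proof (rule sum.cong)
    fix x assume "x \<in> I"
    then obtain A B where x: "x = (A, B)" and AB: "A \<subseteq> {0..<n}" "B \<subseteq> {0..<n}" "A \<inter> B = {}" "card A = s" "card B = s"
      by (auto simp: I_def)
    have "inj_on (\<lambda>(a, b). {a, b}) (A \<times> B)"
      using AB(3) by (auto simp: inj_on_def doubleton_eq_iff)
    then have "card (cut x) = s * s"
      unfolding x cut_def by (simp add: card_image card_cartesian_product AB)
    moreover have "cut x \<subseteq> all_edges n"
    proof
      fix e assume "e \<in> cut x"
      then obtain a b where "e = {a, b}" "a \<in> A" "b \<in> B" by (auto simp: x cut_def)
      moreover from this AB(3) have "a \<noteq> b" by auto
      ultimately show "e \<in> all_edges n" using AB(1,2) by (auto simp: all_edges_eq)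
    qed
    ultimately show "measure_pmf.prob (Gnp n p) (ev x) = (1 - p) ^ (s * s)"
      unfolding ev_def using prob_Gnp_edges[OF assms, of "cut x" n False] by simp
  qed simp
  also have "\<dots> = real (card I) * (1 - p) ^ (s * s)" by simp
  also have "\<dots> \<le> 4 ^ n * (1 - p) ^ (s * s)"
    using cardI assms by (intro mult_right_mono) auto
  finally show ?thesis .
qed

text \<open>When finished and unvisited vertices are equal in number, there are fewer than
  \<open>s\<close> of each, because no unvisited vertex is related to a finished one. All other
  vertices lie on the stack, which is a path.\<close>

lemma long_path:
  fixes R :: "'a \<Rightarrow> 'a \<Rightarrow> bool"
  assumes "finite V"
    and "\<And>A B. A \<subseteq> V \<Longrightarrow> B \<subseteq> V \<Longrightarrow> A \<inter> B = {} \<Longrightarrow> card A = s \<Longrightarrow> card B = s \<Longrightarrow> \<exists>a\<in>A. \<exists>b\<in>B. R a b"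
  obtains P where "distinct P" "set P \<subseteq> V" "successively R P" "card V < length P + 2 * s"
proof -
  \<comment> \<open>depth-first search: \<open>P\<close> is the stack with its top at the head, \<open>S\<close> is finished, \<open>U\<close> is unvisited\<close>
  define inv where "inv P S U \<longleftrightarrow> distinct P \<and> set P \<union> S \<union> U = V \<and> set P \<inter> S = {} \<and> set P \<inter> U = {} \<and> S \<inter> U = {} \<and>
    successively R P \<and> (\<forall>a\<in>U. \<forall>b\<in>S. \<not> R a b)" for P S U
  \<comment> \<open>each step raises \<open>card S - card U\<close> by one, so it vanishes at some time\<close>
  have "\<exists>P S U. inv P S U \<and> card S + card V = t + card U" if "t \<le> 2 * card V" for t
    using that
  proof (induction t)
    case 0
    have "inv [] {} V" by (simp add: inv_def)
    then show ?case by force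
  next
    case (Suc t)
    then obtain P S U where I: "inv P S U" "card S + card V = t + card U" by auto
    have fin: "finite S" "finite U"
      using I(1) \<open>finite V\<close> by (auto simp: inv_def)
    have push: ?case if "u \<in> U" "P = [] \<or> R u (hd P)" for u
    proof -
      have "inv (u # P) S (U - {u})"
        using I(1) that by (cases P) (auto simp: inv_def)
      moreover have "card U = Suc (card (U - {u}))"
        using fin that(1) by (metis card_Suc_Diff1)
      ultimately show ?thesis using I(2) by (intro exI[of _ "u # P"] exI[of _ S] exI[of _ "U - {u}"]) simp
    qed
    show ?case
    proof (cases P)
      case Nil
      \<comment> \<open>An empty stack and an empty \<open>U\<close> would mean
        \<open>S = V\<close>, hence \<open>t = 2 * card V\<close>, although another step is still
        due.\<close>
      have "U \<noteq> {}"
      proof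
        assume "U = {}"
        then have "S = V" using I(1) Nil by (simp add: inv_def)
        then show False using I(2) Suc.prems \<open>U = {}\<close> by simp
      qed
      then show ?thesis using push Nil by blast
    next
      case (Cons x xs)
      show ?thesis
      proof (cases "\<exists>u\<in>U. R u x")
        case True
        then show ?thesis using push Cons by auto
      next
        case False
        \<comment> \<open>\<open>x\<close> is popped only when no unvisited vertex is related to it,
          which preserves the separation of \<open>U\<close> from \<open>S\<close>.\<close>
        then have "inv xs (insert x S) U"
          using I(1) Cons by (cases xs) (auto simp: inv_def)
        moreover have "x \<notin> S" using I(1) Cons by (auto simp: inv_def)
        ultimately show ?thesis
          using I(2) fin by (intro exI[of _ xs] exI[of _ "insert x S"] exI[of _ U]) simp
      qed
    qed
  qed
  from this[of "card V"] obtain P S U where I: "inv P S U" and SU: "card S = card U" by auto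
  have "card S < s"
  proof (rule ccontr)
    assume "\<not> card S < s"
    then obtain A B where "A \<subseteq> U" "card A = s" "B \<subseteq> S" "card B = s"
      using SU by (metis not_less obtain_subset_with_card_n)
    moreover from this I have "\<exists>a\<in>A. \<exists>b\<in>B. R a b"
      by (intro assms(2)) (auto simp: inv_def)
    ultimately show False using I unfolding inv_def by blast
  qed
  moreover have "card V \<le> length P + card S + card U"
  proof -
    have "card V = card (set P \<union> S \<union> U)" using I by (simp add: inv_def)
    also have "\<dots> \<le> card (set P \<union> S) + card U" by (rule card_Un_le)
    also have "card (set P \<union> S) \<le> card (set P) + card S" by (rule card_Un_le)
    also have "card (set P) \<le> length P" by (rule card_length)
    finally show ?thesis by simp
  qed
  ultimately show thesis
    using I SU that[of P] unfolding inv_def by auto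
qed

section \<open>Subgraphs containing a Hamiltonian path\<close>

definition path_edges :: "nat \<Rightarrow> nat set set" where
  "path_edges k = (\<lambda>i. {i, Suc i}) ` {i. Suc i < k}"

lemma path_edges_subset: "path_edges k \<subseteq> all_edges k"
  by (auto simp: path_edges_def all_edges_def)

lemma card_path_edges_le: "card (path_edges k) \<le> k"
proof -
  have "card (path_edges k) \<le> card {..<k}"
    unfolding path_edges_def by (rule order_trans[OF card_image_le card_mono]) (auto intro: finite_subset[of _ "{..<k}"])
  then show ?thesis by simp
qed

text \<open>Follow the path from its start: the next edge under \<open>\<sigma>\<close> is an edge
  of the path under \<open>\<tau>\<close> at the same vertex, hence the next one there or the
  previous one, and injectivity of \<open>\<sigma>\<close> rules out turning back.\<close>

lemma path_rigid:
  assumes \<sigma>: "inj_on \<sigma> {0..<k}" and \<tau>: "inj_on \<tau> {0..<k}"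
    and edges: "(`) \<sigma> ` path_edges k = (`) \<tau> ` path_edges k" and zero: "\<sigma> 0 = \<tau> 0"
  shows "i < k \<Longrightarrow> \<sigma> i = \<tau> i"
proof (induction i rule: less_induct)
  case (less i)
  show ?case
  proof (cases i)
    case 0
    then show ?thesis using zero by simp
  next
    case (Suc m)
    then have "{m, i} \<in> path_edges k"
      using less.prems by (auto simp: path_edges_def)
    then have "\<sigma> ` {m, i} \<in> (`) \<tau> ` path_edges k"
      unfolding edges[symmetric] by (rule imageI)
    then obtain a where a: "Suc a < k" "{\<sigma> m, \<sigma> i} = {\<tau> a, \<tau> (Suc a)}"
      by (auto simp: path_edges_def)
    have m: "\<sigma> m = \<tau> m" using less Suc by simp
    from a(2) consider "\<sigma> m = \<tau> a" "\<sigma> i = \<tau> (Suc a)" | "\<sigma> m = \<tau> (Suc a)" "\<sigma> i = \<tau> a"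
      by (auto simp: doubleton_eq_iff)
    then show ?thesis
    proof cases
      case 1
      then have "m = a"
        using m a(1) less.prems Suc \<tau> by (auto simp: inj_on_def)
      then show ?thesis using 1 Suc by simp
    next
      case 2
      then have "m = Suc a"
        using m a(1) less.prems Suc \<tau> by (auto simp: inj_on_def)
      then have "\<sigma> i = \<sigma> a" using 2 less.IH[of a] a(1) Suc by simp
      then have "i = a"
        using \<sigma> less.prems a(1) by (auto simp: inj_on_def)
      then show ?thesis using Suc \<open>m = Suc a\<close> by simp
    qed
  qed
qed

text \<open>In the class of \<open>F0\<close>, choose isomorphisms \<open>\<sigma> F\<close> onto
  \<open>F0\<close>. By rigidity the pair \<open>h F\<close> determines \<open>\<sigma> F\<close>,
  hence \<open>F\<close>; its first entry is a subset of \<open>F0\<close>, with at most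
  \<open>2 ^ (2 * k) = 4 ^ k\<close> values.\<close>

lemma card_le_iso_classes:
  assumes "finite \<F>" "0 < k"
    and \<F>: "\<And>F. F \<in> \<F> \<Longrightarrow> path_edges k \<subseteq> F" "\<And>F. F \<in> \<F> \<Longrightarrow> F \<subseteq> all_edges k" "\<And>F. F \<in> \<F> \<Longrightarrow> card F \<le> 2 * k"
  shows "card \<F> \<le> card (iso_class k ` \<F>) * (4 ^ k * k)"
proof -
  have fiber: "card {F \<in> \<F>. iso_class k F = iso_class k F0} \<le> 4 ^ k * k" if F0: "F0 \<in> \<F>" for F0
  proof -
    have "graph_iso k F F0" if "F \<in> \<F>" "iso_class k F = iso_class k F0" for F
      using iso_class_eq_iff[of F0 k F] \<F>(2)[OF F0] that by simp
    then have "\<forall>F. \<exists>\<sigma>. F \<in> \<F> \<and> iso_class k F = iso_class k F0 \<longrightarrow>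
        bij_betw \<sigma> {0..<k} {0..<k} \<and> (\<forall>e\<in>all_edges k. e \<in> F \<longleftrightarrow> \<sigma> ` e \<in> F0)"
      unfolding graph_iso_def by blast
    then obtain \<sigma> where "\<forall>F. F \<in> \<F> \<and> iso_class k F = iso_class k F0 \<longrightarrow>
        bij_betw (\<sigma> F) {0..<k} {0..<k} \<and> (\<forall>e\<in>all_edges k. e \<in> F \<longleftrightarrow> \<sigma> F ` e \<in> F0)"
      by (rule choice[THEN exE])
    then have \<sigma>: "bij_betw (\<sigma> F) {0..<k} {0..<k}" "\<And>e. e \<in> all_edges k \<Longrightarrow> e \<in> F \<longleftrightarrow> \<sigma> F ` e \<in> F0"
      if "F \<in> \<F>" "iso_class k F = iso_class k F0" for F
      using that by simp_all
    define h where "h F = ((`) (\<sigma> F) ` path_edges k, \<sigma> F 0)" for F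
    have "inj_on h {F \<in> \<F>. iso_class k F = iso_class k F0}"
    proof (rule inj_onI)
      fix F F' assume FF': "F \<in> {F \<in> \<F>. iso_class k F = iso_class k F0}"
        "F' \<in> {F \<in> \<F>. iso_class k F = iso_class k F0}" "h F = h F'"
      then have F: "F \<in> \<F>" "iso_class k F = iso_class k F0" and F': "F' \<in> \<F>" "iso_class k F' = iso_class k F0"
        by auto
      have "\<sigma> F i = \<sigma> F' i" if "i < k" for i
      proof (rule path_rigid[OF _ _ _ _ that])
        show "inj_on (\<sigma> F) {0..<k}" "inj_on (\<sigma> F') {0..<k}"
          using \<sigma>(1)[OF F] \<sigma>(1)[OF F'] by (simp_all only: bij_betw_def)
        show "(`) (\<sigma> F) ` path_edges k = (`) (\<sigma> F') ` path_edges k" "\<sigma> F 0 = \<sigma> F' 0"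
          using FF'(3) unfolding h_def by (simp_all only: prod.inject)
      qed
      then have "\<sigma> F ` e = \<sigma> F' ` e" if "e \<in> all_edges k" for e
        using all_edges_less[OF that] by (intro image_cong) auto
      then have "e \<in> F \<longleftrightarrow> e \<in> F'" if "e \<in> all_edges k" for e
        using \<sigma>(2)[OF F that] \<sigma>(2)[OF F' that] that by simp
      then show "F = F'" using \<F>(2)[OF F(1)] \<F>(2)[OF F'(1)] by blast
    qed
    moreover have "h ` {F \<in> \<F>. iso_class k F = iso_class k F0} \<subseteq> Pow F0 \<times> {0..<k}"
    proof (rule image_subsetI)
      fix F assume "F \<in> {F \<in> \<F>. iso_class k F = iso_class k F0}"
      then have F: "F \<in> \<F>" "iso_class k F = iso_class k F0" by auto
      have "(`) (\<sigma> F) ` path_edges k \<subseteq> F0"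
        using \<sigma>(2)[OF F(1,2)] \<F>(1)[OF F(1)] path_edges_subset[of k] by auto
      moreover have "\<sigma> F 0 \<in> {0..<k}"
        using bij_betwE[OF \<sigma>(1)[OF F(1,2)]] \<open>0 < k\<close> by simp
      ultimately show "h F \<in> Pow F0 \<times> {0..<k}"
        by (simp add: h_def)
    qed
    moreover have "finite F0" using \<F>(2)[OF F0] by (rule finite_subset) simp
    ultimately have "card {F \<in> \<F>. iso_class k F = iso_class k F0} \<le> card (Pow F0 \<times> {0..<k})"
      by (intro card_inj_on_le) auto
    also have "\<dots> = 2 ^ card F0 * k"
      using \<open>finite F0\<close> by (simp add: card_cartesian_product card_Pow)
    also have "\<dots> \<le> 2 ^ (2 * k) * k"
      using \<F>(3)[OF F0] by (intro mult_right_mono power_increasing) auto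
    finally show ?thesis by (simp add: power_mult)
  qed
  have "\<F> = (\<Union>c\<in>iso_class k ` \<F>. {F \<in> \<F>. iso_class k F = c})" by auto
  then have "card \<F> \<le> (\<Sum>c\<in>iso_class k ` \<F>. card {F \<in> \<F>. iso_class k F = c})"
    using card_UN_le[of "iso_class k ` \<F>" "\<lambda>c. {F \<in> \<F>. iso_class k F = c}"] \<open>finite \<F>\<close> by simp
  also have "\<dots> \<le> (\<Sum>c\<in>iso_class k ` \<F>. 4 ^ k * k)"
    using fiber by (intro sum_mono) auto
  finally show ?thesis by simp
qed

text \<open>All but fewer than \<open>s\<close> labels above \<open>h\<close> lie in
  \<open>Y\<close>: \<open>s\<close> exceptions would have at most \<open>s * r\<close> neighbours
  below \<open>h\<close> in total, leaving \<open>s\<close> labels there without an edge to them.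
  Each \<open>y\<close> in \<open>Y\<close> then chooses one neighbour below \<open>h\<close>, in at
  least \<open>r\<close> ways.\<close>

lemma many_iso_classes:
  assumes E: "E \<subseteq> all_edges k" "path_edges k \<subseteq> E" and "h < k" and s: "s * (r + 1) \<le> h"
    and ex: "\<And>A B. A \<subseteq> {0..<k} \<Longrightarrow> B \<subseteq> {0..<k} \<Longrightarrow> A \<inter> B = {} \<Longrightarrow> card A = s \<Longrightarrow> card B = s \<Longrightarrow>
      \<exists>a\<in>A. \<exists>b\<in>B. {a, b} \<in> E"
    and "0 < r"
  shows "r ^ (k - Suc h - s) \<le> card (iso_class k ` {F. F \<subseteq> E}) * (4 ^ k * k)"
proof -
  define N where "N y = {x \<in> {0..<h}. {x, y} \<in> E}" for y
  \<comment> \<open>Leaving out the label \<open>h\<close> keeps the ends of a chosen edge from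
    being consecutive on the path.\<close>
  define Y where "Y = {y \<in> {Suc h..<k}. r \<le> card (N y)}"
  define H where "H \<phi> = path_edges k \<union> (\<lambda>y. {\<phi> y, y}) ` Y" for \<phi>
  have finN: "finite (N y)" for y by (simp add: N_def)
  have finE: "finite E" using E(1) by (rule finite_subset) simp
  have "card ({Suc h..<k} - Y) < s"
  proof (rule ccontr)
    assume "\<not> ?thesis"
    then obtain B where B: "B \<subseteq> {Suc h..<k} - Y" "card B = s"
      by (meson not_less obtain_subset_with_card_n)
    then have finB: "finite B" by (meson finite_Diff finite_atLeastLessThan finite_subset)
    have "card (\<Union>y\<in>B. N y) \<le> (\<Sum>y\<in>B. card (N y))"
      using finB by (rule card_UN_le)
    also have "\<dots> \<le> (\<Sum>y\<in>B. r)"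
      using B(1) by (intro sum_mono) (auto simp: Y_def)
    finally have "card (\<Union>y\<in>B. N y) \<le> s * r" using B(2) by simp
    then have "s \<le> card ({0..<h} - (\<Union>y\<in>B. N y))"
      using s diff_card_le_card_Diff[of "\<Union>y\<in>B. N y" "{0..<h}"] finB finN by simp
    then obtain A where A: "A \<subseteq> {0..<h} - (\<Union>y\<in>B. N y)" "card A = s"
      by (meson obtain_subset_with_card_n)
    have "\<exists>a\<in>A. \<exists>b\<in>B. {a, b} \<in> E"
    proof (rule ex)
      show "A \<subseteq> {0..<k}" "B \<subseteq> {0..<k}" using A(1) B(1) \<open>h < k\<close> by auto
      have "a < h" "\<not> b \<le> h" if "a \<in> A" "b \<in> B" for a b
        using that A(1) B(1) by auto
      then show "A \<inter> B = {}" by fastforce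
    qed (use A B in auto)
    then obtain a b where "a \<in> A" "b \<in> B" "{a, b} \<in> E" by blast
    moreover from this A(1) have "a \<in> N b" by (auto simp: N_def)
    ultimately show False using A(1) by blast
  qed
  moreover have "card {Suc h..<k} \<le> card Y + card ({Suc h..<k} - Y)"
    by (rule order_trans[OF card_mono card_Un_le]) (auto simp: Y_def)
  ultimately have "k - Suc h - s \<le> card Y" by simp
  then have "r ^ (k - Suc h - s) \<le> r ^ card Y"
    using \<open>0 < r\<close> by (intro power_increasing) auto
  also have "\<dots> = (\<Prod>y\<in>Y. r)" by simp
  also have "\<dots> \<le> (\<Prod>y\<in>Y. card (N y))"
    by (rule prod_mono) (auto simp: Y_def)
  also have "\<dots> = card (Pi\<^sub>E Y N)"
    by (rule card_PiE[symmetric]) (simp add: Y_def)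
  \<comment> \<open>An edge of \<open>H \<phi>\<close> from below \<open>h\<close> to above
    \<open>h\<close> is not a path edge, and its upper end is the argument at which it reveals the
    value of \<open>\<phi>\<close>.\<close>
  also have "\<dots> = card (H ` Pi\<^sub>E Y N)"
  proof (rule card_image[symmetric], rule inj_onI)
    fix \<phi> \<psi> assume \<phi>: "\<phi> \<in> Pi\<^sub>E Y N" and \<psi>: "\<psi> \<in> Pi\<^sub>E Y N" and "H \<phi> = H \<psi>"
    show "\<phi> = \<psi>"
    proof (rule PiE_ext[OF \<phi> \<psi>])
      fix y assume y: "y \<in> Y"
      have less: "\<phi> y < h" "h < y" using PiE_mem[OF \<phi> y] y by (auto simp: N_def Y_def)
      then have "{\<phi> y, y} \<notin> path_edges k"
        by (auto simp: path_edges_def doubleton_eq_iff)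
      moreover have "{\<phi> y, y} \<in> H \<psi>"
        using y \<open>H \<phi> = H \<psi>\<close> unfolding H_def by blast
      ultimately obtain y' where y': "y' \<in> Y" "{\<phi> y, y} = {\<psi> y', y'}" by (auto simp: H_def)
      have "\<psi> y' < h" "h < y'" using PiE_mem[OF \<psi> y'(1)] y'(1) by (auto simp: N_def Y_def)
      with less y'(2) show "\<phi> y = \<psi> y" by (auto simp: doubleton_eq_iff)
    qed
  qed
  also have "\<dots> \<le> card (iso_class k ` H ` Pi\<^sub>E Y N) * (4 ^ k * k)"
  proof (rule card_le_iso_classes)
    show "finite (H ` Pi\<^sub>E Y N)"
      using finN by (intro finite_imageI finite_PiE) (auto simp: Y_def)
    fix F assume "F \<in> H ` Pi\<^sub>E Y N"
    then obtain \<phi> where \<phi>: "\<phi> \<in> Pi\<^sub>E Y N" "F = H \<phi>" by blast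
    show "path_edges k \<subseteq> F" by (simp add: \<phi>(2) H_def)
    have "(\<lambda>y. {\<phi> y, y}) ` Y \<subseteq> E" using \<phi>(1) by (auto simp: N_def)
    then show "F \<subseteq> all_edges k" using E by (auto simp: \<phi>(2) H_def)
    have "card F \<le> card (path_edges k) + card ((\<lambda>y. {\<phi> y, y}) ` Y)"
      unfolding \<phi>(2) H_def by (rule card_Un_le)
    also have "\<dots> \<le> k + card Y"
      by (intro add_mono card_path_edges_le card_image_le) (simp add: Y_def)
    also have "card Y \<le> card {0..<k}" by (rule card_mono) (auto simp: Y_def)
    finally show "card F \<le> 2 * k" by simp
  qed (use \<open>h < k\<close> in simp)
  also have "\<dots> \<le> card (iso_class k ` {F. F \<subseteq> E}) * (4 ^ k * k)"
  proof (intro mult_right_mono card_mono image_mono subsetI)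
    fix F assume "F \<in> H ` Pi\<^sub>E Y N"
    then obtain \<phi> where \<phi>: "\<phi> \<in> Pi\<^sub>E Y N" "F = H \<phi>" by blast
    then have "(\<lambda>y. {\<phi> y, y}) ` Y \<subseteq> E" by (auto simp: N_def)
    then show "F \<in> {F. F \<subseteq> E}" using E(2) by (auto simp: \<phi>(2) H_def)
  qed (use finE in auto)
  finally show ?thesis .
qed

section \<open>Failure of tininess in expanding graphs and in the random graph\<close>

text \<open>As \<open>16 * s \<le> n\<close>, the path has \<open>k \<ge> 7 * n / 8\<close>
  vertices. With \<open>h = k div 2\<close> the exponent is at least
  \<open>7 * n / 16 - 1 - n / 16\<close>, which is at least \<open>n / 4\<close> once
  \<open>n \<ge> 8\<close>.\<close>

lemma s_sub_ge_if_expanding: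
  assumes G: "expanding n s G" and "0 < r" and s: "8 * (s * (r + 1)) \<le> n" and "8 \<le> n"
  obtains k x where "k \<in> {1..n}" "n \<le> 4 * x" "r ^ x \<le> s_sub k n G * (4 ^ k * k)"
proof -
  have "\<exists>a\<in>A. \<exists>b\<in>B. G {a, b}" if "A \<subseteq> {0..<n}" "B \<subseteq> {0..<n}" "A \<inter> B = {}" "card A = s" "card B = s" for A B
    using G that unfolding expanding_def by blast
  then obtain P where P: "distinct P" "set P \<subseteq> {0..<n}" "successively (\<lambda>a b. G {a, b}) P" "n < length P + 2 * s"
    using long_path[of "{0..<n}" s "\<lambda>a b. G {a, b}"] by auto
  define k where "k = length P"
  define v where "v i = P ! i" for i
  have v: "inj_on v {0..<k}" "v ` {0..<k} \<subseteq> {0..<n}"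
    using P(1,2) by (auto simp: v_def k_def inj_on_def nth_eq_iff_index_eq)
  have "k \<le> n"
    using card_inj_on_le[OF v] by simp
  \<comment> \<open>The host graph pulled back along \<open>v\<close>, so that labels are positions
    on the path.\<close>
  define E where "E = {e \<in> all_edges k. G (v ` e)}"
  define h where "h = k div 2"
  have "2 * s \<le> s * (r + 1)" using \<open>0 < r\<close> by (cases r) auto
  then have "16 * s \<le> n" using s by linarith
  then have k: "8 * k \<ge> 7 * n" using P(4) by (simp add: k_def)
  have "r ^ (k - Suc h - s) \<le> card (iso_class k ` {F. F \<subseteq> E}) * (4 ^ k * k)"
  proof (rule many_iso_classes)
    show "path_edges k \<subseteq> E"
      using P(3) by (auto simp: E_def path_edges_def all_edges_def successively_conv_nth k_def v_def)
    show "h < k" "s * (r + 1) \<le> h" using k s \<open>8 \<le> n\<close> by (auto simp: h_def)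
    fix A B assume AB: "A \<subseteq> {0..<k}" "B \<subseteq> {0..<k}" "A \<inter> B = {}" "card A = s" "card B = s"
    have "card (v ` A) = s" "card (v ` B) = s"
      using AB v(1) by (metis card_image inj_on_subset)+
    moreover have "v ` A \<inter> v ` B = {}"
      using AB v(1) by (metis image_empty inj_on_image_Int)
    moreover have "v ` A \<subseteq> {0..<n}" "v ` B \<subseteq> {0..<n}"
      using AB v(2) by blast+
    ultimately have "\<exists>a'\<in>v ` A. \<exists>b'\<in>v ` B. G {a', b'}"
      using G unfolding expanding_def by blast
    then obtain a b where "a \<in> A" "b \<in> B" "G {v a, v b}" by blast
    moreover from this AB have "a \<noteq> b" by auto
    then have "{a, b} \<in> all_edges k"
      using \<open>a \<in> A\<close> \<open>b \<in> B\<close> AB(1,2) by (auto simp: all_edges_eq)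
    ultimately show "\<exists>a\<in>A. \<exists>b\<in>B. {a, b} \<in> E" by (auto simp: E_def)
  qed (use \<open>0 < r\<close> in \<open>auto simp: E_def\<close>)
  also have "\<dots> \<le> s_sub k n G * (4 ^ k * k)"
  proof (rule mult_right_mono)
    have "is_sub k F n G" if "F \<subseteq> E" for F
      unfolding is_sub_def using that v image_all_edges[OF v] by (intro exI[of _ v]) (auto simp: E_def)
    then show "card (iso_class k ` {F. F \<subseteq> E}) \<le> s_sub k n G"
      unfolding s_sub_eq by (intro card_mono image_mono finite_imageI) (auto simp: E_def)
  qed simp
  finally have "r ^ (k - Suc h - s) \<le> s_sub k n G * (4 ^ k * k)" .
  moreover have "n \<le> 4 * (k - Suc h - s)" "k \<in> {1..n}"
    using k \<open>16 * s \<le> n\<close> \<open>k \<le> n\<close> \<open>8 \<le> n\<close> by (auto simp: h_def)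
  ultimately show thesis using that by blast
qed

text \<open>Tininess would give \<open>r ^ x \<le> c ^ k * (4 ^ k * k) \<le> (8 * c) ^ k\<close> by
  \<open>k < 2 ^ k\<close>. As \<open>k \<le> n \<le> 4 * x\<close> and
  \<open>8 * c \<ge> 1\<close>, this is at most \<open>((8 * c) ^ 4) ^ x\<close>, hence less than
  \<open>r ^ x\<close>.\<close>

lemma not_mono_tiny_if_expanding:
  fixes c :: real
  assumes G: "expanding n s G" and s: "8 * (s * (r + 1)) \<le> n" and "8 \<le> n"
    and c: "1 \<le> c" "(8 * c) ^ 4 < real r"
  shows "\<not> mono_tiny c n G"
proof
  assume tiny: "mono_tiny c n G"
  have "0 < (8 * c) ^ 4" using c(1) by simp
  then have "0 < r" using c(2) by (metis less_trans of_nat_0_less_iff)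
  then obtain k x where k: "k \<in> {1..n}" "n \<le> 4 * x" "r ^ x \<le> s_sub k n G * (4 ^ k * k)"
    using s_sub_ge_if_expanding[OF G _ s \<open>8 \<le> n\<close>] by blast
  have "real r ^ x = real (r ^ x)" by simp
  also have "\<dots> \<le> real (s_sub k n G * (4 ^ k * k))"
    using k(3) by (rule of_nat_mono)
  also have "\<dots> = real (s_sub k n G) * (4 ^ k * real k)" by simp
  also have "\<dots> \<le> c ^ k * (4 ^ k * 2 ^ k)"
    using tiny k(1) c(1) of_nat_less_two_power[of k, where 'a = real]
    by (intro mult_mono) (auto simp: mono_tiny_def)
  also have "\<dots> = (c * (4 * 2)) ^ k"
    by (simp only: power_mult_distrib)
  also have "\<dots> = (8 * c) ^ k" by (simp add: mult.commute)
  also have "\<dots> \<le> (8 * c) ^ (4 * x)"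
    using k(1,2) c(1) by (intro power_increasing) auto
  also have "\<dots> = ((8 * c) ^ 4) ^ x" by (simp add: power_mult)
  also have "\<dots> < real r ^ x"
    using c k(2) \<open>8 \<le> n\<close> by (intro power_strict_mono) auto
  finally show False by simp
qed

lemma mono_tiny_mono:
  assumes "mono_tiny c n G" "0 \<le> c" "c \<le> c'"
  shows "mono_tiny c' n G"
  unfolding mono_tiny_def
proof
  fix k assume "k \<in> {1..n}"
  then have "real (s_sub k n G) \<le> c ^ k" using assms(1) by (simp add: mono_tiny_def)
  also have "\<dots> \<le> c' ^ k" using assms(2,3) by (intro power_mono)
  finally show "real (s_sub k n G) \<le> c' ^ k" .
qed

lemma random_graph_not_mono_tiny:
  fixes c :: real
  assumes "0 < c"
  shows "\<exists>d\<ge>0. whp (\<lambda>n. d / real n) (\<lambda>n G. \<not> mono_tiny c n G)"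
proof -
  \<comment> \<open>The counting argument needs a base of at least \<open>1\<close>; failing to be
    tiny for \<open>c'\<close> implies the same for \<open>c\<close>.\<close>
  define c' where "c' = max c 1"
  obtain r :: nat where r: "(8 * c') ^ 4 < real r" using reals_Archimedean2 by blast
  \<comment> \<open>Chosen so that \<open>s = n div m\<close> satisfies
    \<open>8 * (s * (r + 1)) \<le> n\<close>.\<close>
  define m where "m = 8 * (r + 1)"
  \<comment> \<open>For \<open>n \<ge> m\<close> one has \<open>n \<le> 2 * s * m\<close>, so this
    \<open>d\<close> gives \<open>p * s ^ 2 \<ge> 3 * n\<close>; then \<open>exp (- 3 * n)\<close>
    beats the \<open>4 ^ n\<close> pairs of sets, as \<open>exp 3 \<ge> 8\<close>.\<close>
  define d where "d = 12 * real m ^ 2"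
  have "0 < m" by (simp add: m_def)
  have "whp (\<lambda>n. d / real n) (\<lambda>n G. \<not> mono_tiny c n G)"
  proof (rule whpI)
    have "\<forall>\<^sub>F n in sequentially. nat \<lceil>d\<rceil> + m \<le> n"
      by (rule eventually_ge_at_top)
    then show "\<forall>\<^sub>F n in sequentially.
        measure_pmf.prob (Gnp n (d / real n)) {G. \<not> \<not> mono_tiny c n G} \<le> (1 / 2) ^ n"
    proof (rule eventually_mono)
      fix n assume n: "nat \<lceil>d\<rceil> + m \<le> n"
      then have "m \<le> n" "d \<le> real n" by linarith+
      then have "8 \<le> n" by (simp add: m_def)
      define s where "s = n div m"
      define p where "p = d / real n"
      have p: "0 \<le> p" "p \<le> 1"
        using \<open>d \<le> real n\<close> \<open>8 \<le> n\<close> by (auto simp: p_def d_def)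
      have "s * m \<le> n" by (simp add: s_def)
      then have s: "8 * (s * (r + 1)) \<le> n" by (simp add: m_def algebra_simps)
      have "1 \<le> s"
        using \<open>m \<le> n\<close> \<open>0 < m\<close> by (simp add: s_def Suc_le_eq div_greater_zero_iff)
      then have "m \<le> s * m" by simp
      have "n = s * m + n mod m" by (simp add: s_def)
      then have "n \<le> 2 * (s * m)"
        using mod_less_divisor[OF \<open>0 < m\<close>, of n] \<open>m \<le> s * m\<close> by linarith
      then have "n * n \<le> (2 * (s * m)) * (2 * (s * m))" by (rule mult_le_mono) fact
      then have "real (n * n) \<le> real ((2 * (s * m)) * (2 * (s * m)))" by (rule of_nat_mono)
      then have "3 * (real n * real n) \<le> d * real (s * s)"
        by (simp add: d_def power2_eq_square mult_ac)
      then have ps: "3 * real n \<le> p * real (s * s)"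
        using \<open>8 \<le> n\<close> by (simp add: p_def field_simps)
      have "2 ^ 3 \<le> exp (1::real) ^ 3"
        by (rule power_mono) (use exp_ge_add_one_self[of "1::real"] in auto)
      then have exp3: "8 \<le> exp (3::real)" by (simp flip: exp_of_nat_mult)
      have "measure_pmf.prob (Gnp n p) {G. \<not> \<not> mono_tiny c n G} \<le>
          measure_pmf.prob (Gnp n p) {G. \<not> expanding n s G}"
      proof (intro measure_pmf.finite_measure_mono subsetI)
        fix G assume "G \<in> {G. \<not> \<not> mono_tiny c n G}"
        then have "mono_tiny c' n G"
          using assms by (auto simp: c'_def intro: mono_tiny_mono)
        then show "G \<in> {G. \<not> expanding n s G}"
          using not_mono_tiny_if_expanding[OF _ s \<open>8 \<le> n\<close> _ r] by (auto simp: c'_def)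
      qed simp
      also have "\<dots> \<le> 4 ^ n * (1 - p) ^ (s * s)"
        using p by (rule prob_not_expanding)
      also have "\<dots> \<le> 4 ^ n * exp (- p) ^ (s * s)"
        using p exp_ge_add_one_self[of "- p"] by (intro mult_left_mono power_mono) auto
      also have "\<dots> = 4 ^ n * exp (- (p * real (s * s)))"
        by (simp flip: exp_of_nat_mult add: mult_ac)
      also have "\<dots> \<le> 4 ^ n * exp (- (3 * real n))"
        using ps by (intro mult_left_mono) auto
      also have "\<dots> = (4 / exp 3) ^ n"
        by (simp add: exp_minus exp_of_nat2_mult power_divide divide_inverse power_inverse)
      also have "\<dots> \<le> (1 / 2) ^ n"
        using exp3 by (intro power_mono) (auto simp: field_simps)
      finally show "measure_pmf.prob (Gnp n (d / real n)) {G. \<not> \<not> mono_tiny c n G} \<le> (1 / 2) ^ n"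
        by (simp add: p_def)
    qed
    show "(\<lambda>n. (1 / 2 :: real) ^ n) \<longlonglongrightarrow> 0" by (rule LIMSEQ_power_zero) simp
  qed
  then show ?thesis by (intro exI[of _ d]) (simp add: d_def)
qed

theorem theorem1p3:
  shows "(\<forall>d1::real. d1 \<ge> 0 \<longrightarrow>
            (\<exists>c::real. c > 0 \<and> whp (\<lambda>n. d1 / real n) (\<lambda>n G. mono_tiny c n G)))
       \<and> (\<forall>c::real. c > 0 \<longrightarrow>
            (\<exists>d2::real. d2 \<ge> 0 \<and> whp (\<lambda>n. d2 / real n) (\<lambda>n G. \<not> mono_tiny c n G)))"
  using random_graph_mono_tiny random_graph_not_mono_tiny by blast

end
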